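(* There exists a smooth metric $g_Q=Q(x)\,(dx^2+dy^2)$ on the torus $\mathbb{T}^2=(\mathbb{R}/2\pi\mathbb{Z})^2$, where $Q$ is a positive $C^\infty$ function on $\mathbb{R}/2\pi\mathbb{Z}$, and an eigenfunction $\Phi$ of the associated Laplace-Beltrami operator $\Delta_Q\Phi:=Q^{-1}\Delta_0\Phi$, such that the super-level set $\{\Phi>1\}$ has infinitely many connected components. As a consequence, the Extended Courant Property is false for $(\mathbb{T}^2,g_Q)$.
   Context: $(x,y)$ are the standard coordinates on $\mathbb{T}^2$, and $\Delta_0=\partial_x^2+\partial_y^2$. For a closed surface $(\Omega,g)$, the eigenvalues of $-\Delta_g$ are listed in nondecreasing order with multiplicities, $\lambda_1<\lambda_2\le\lambda_3\le\cdots$, and $\mathcal{L}_n(\Omega)$ is the space of linear combinations of eigenfunctions associated with the $n$ first eigenvalues. The nodal domains of a real continuous function $w$ are the connected components of the complement of its zero set, and $\beta_0(w)$ is their number. The Extended Courant Property is the statement that every nontrivial $w\in\mathcal{L}_n(\Omega)$ satisfies $\beta_0(w)\le n$ (for every $n\ge1$). *)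

theory Defs
  imports "HOL-Analysis.Analysis" "HOL-Library.Function_Algebras"
begin

text \<open>Pointwise real vector space structure on functions, so that the library notions
  \<^const>\<open>span\<close> and \<^const>\<open>dim\<close> apply to spaces of functions.\<close>

instantiation "fun" :: (type, real_vector) real_vector
begin

definition scaleR_fun :: "real \<Rightarrow> ('a \<Rightarrow> 'b) \<Rightarrow> 'a \<Rightarrow> 'b"
  where "scaleR_fun c f = (\<lambda>x. c *\<^sub>R f x)"

instance
  by standard
    (auto simp: scaleR_fun_def plus_fun_def fun_eq_iff scaleR_add_left scaleR_add_right)

end


section \<open>Smooth functions on Euclidean spaces\<close>

primrec C_k :: "nat \<Rightarrow> ('a::euclidean_space \<Rightarrow> 'b::euclidean_space) \<Rightarrow> bool" where
  "C_k 0 f \<longleftrightarrow> continuous_on UNIV f"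
| "C_k (Suc k) f \<longleftrightarrow>
     (\<forall>x. f differentiable (at x)) \<and> (\<forall>v. C_k k (\<lambda>x. frechet_derivative f (at x) v))"

definition smooth :: "('a::euclidean_space \<Rightarrow> 'b::euclidean_space) \<Rightarrow> bool"
  where "smooth f \<longleftrightarrow> (\<forall>k. C_k k f)"


section \<open>The torus\<close>

text \<open>A function on \<open>(\<real>/2\<pi>\<int>)\<^sup>2\<close> is represented by its lift to \<open>\<real>\<^sup>2\<close>, a function that is
  \<open>2\<pi>\<close>-periodic in each coordinate.\<close>

definition circle_fun :: "(real \<Rightarrow> 'a) \<Rightarrow> bool"
  where "circle_fun f \<longleftrightarrow> (\<forall>x. f (x + 2 * pi) = f x)"

definition torus_fun :: "(real \<times> real \<Rightarrow> 'a) \<Rightarrow> bool"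
  where "torus_fun f \<longleftrightarrow> (\<forall>x y. f (x + 2 * pi, y) = f (x, y) \<and> f (x, y + 2 * pi) = f (x, y))"

text \<open>As a topological space the torus is realised as the product of two unit circles in the
  complex plane. The two lemmas below show that this is the quotient \<open>\<real>\<^sup>2/(2\<pi>\<int>)\<^sup>2\<close>, with
  quotient map \<open>torus_proj\<close>.\<close>

definition torus :: "(complex \<times> complex) set"
  where "torus = sphere 0 1 \<times> sphere 0 1"

definition torus_proj :: "real \<times> real \<Rightarrow> complex \<times> complex"
  where "torus_proj = (\<lambda>(x, y). (cis x, cis y))"

lemma torus_proj_eq_iff:
  "torus_proj (x, y) = torus_proj (x', y') \<longleftrightarrow>
     (\<exists>m n :: int. x' = x + 2 * pi * of_int m \<and> y' = y + 2 * pi * of_int n)"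
proof -
  have *: "cis a = cis b \<longleftrightarrow> (\<exists>m::int. b = a + 2 * pi * of_int m)" for a b
  proof -
    have "cis a = cis b \<longleftrightarrow> cos b = cos a \<and> sin b = sin a"
      by (auto simp: complex_eq_iff)
    also have "\<dots> \<longleftrightarrow> (\<exists>m::int. b = a + 2 * pi * of_int m)"
      using sin_cos_eq_iff[of b a] by (auto simp: mult_ac)
    finally show ?thesis .
  qed
  show ?thesis by (auto simp: torus_proj_def *)
qed

lemma quotient_map_torus_proj:
  "quotient_map euclidean (top_of_set torus) torus_proj"
proof -
  have cont: "continuous_on S torus_proj" for S
    unfolding torus_proj_def case_prod_beta by (intro continuous_intros)
  let ?K = "{0..2*pi} \<times> {0..2*pi}"
  have ex: "\<exists>q \<in> ?K. torus_proj q = torus_proj p" for p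
  proof -
    obtain x y where p: "p = (x, y)" by force
    have *: "\<exists>t\<in>{0..2*pi}. cis t = cis a" for a :: real
    proof -
      obtain t where "0 \<le> t" "t < 2 * pi" "cis a = cis t"
        using complex_unimodular_polar[of "cis a"] by (auto simp: complex_eq_iff)
      then show ?thesis by (intro bexI[of _ t]) auto
    qed
    obtain s t where "s \<in> {0..2*pi}" "t \<in> {0..2*pi}" "cis s = cis x" "cis t = cis y"
      using * by metis
    then show ?thesis by (intro bexI[of _ "(s, t)"]) (auto simp: p torus_proj_def)
  qed
  have surj: "range torus_proj = torus"
  proof -
    have "z \<in> range torus_proj" if zt: "z \<in> torus" for z
    proof -
      obtain a b where z: "z = (a, b)" "norm a = 1" "norm b = 1"
        using zt by (cases z) (auto simp: torus_def)
      then have "a \<noteq> 0" "b \<noteq> 0"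
        by auto
      with z have "z = torus_proj (Arg a, Arg b)"
        using cis_Arg[of a] cis_Arg[of b] by (auto simp: torus_proj_def sgn_eq)
      then show ?thesis by blast
    qed
    then show ?thesis by (auto simp: torus_def torus_proj_def)
  qed
  have "closedin (top_of_set torus) C" if "C \<subseteq> torus" and C: "closed {p. torus_proj p \<in> C}" for C
  proof -
    have "C = torus_proj ` ({p. torus_proj p \<in> C} \<inter> ?K)"
    proof (intro equalityI subsetI)
      fix z assume "z \<in> C"
      with that surj obtain p where "z = torus_proj p" by blast
      with ex[of p] \<open>z \<in> C\<close> show "z \<in> torus_proj ` ({p. torus_proj p \<in> C} \<inter> ?K)"
        by (metis (mono_tags, lifting) IntI image_eqI mem_Collect_eq)
    qed auto
    moreover have "compact ({p. torus_proj p \<in> C} \<inter> ?K)"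
      using C by (intro closed_Int_compact compact_Times compact_Icc)
    ultimately have "closed C"
      using compact_continuous_image[OF cont] compact_imp_closed by metis
    then show ?thesis using that by (intro closed_subset) auto
  qed
  moreover have "closed {p. torus_proj p \<in> C}" if "closedin (top_of_set torus) C" for C
  proof -
    have "continuous_map euclidean (top_of_set torus) torus_proj"
      using cont surj by (auto simp: continuous_map_in_subtopology)
    from closedin_continuous_map_preimage[OF this that] show ?thesis by simp
  qed
  ultimately show ?thesis
    using surj by (auto simp: quotient_map_closedin)
qed


section \<open>The Laplace-Beltrami operator of the metric \<open>Q(x) (dx\<^sup>2 + dy\<^sup>2)\<close>\<close>

definition laplacian :: "(real \<times> real \<Rightarrow> real) \<Rightarrow> real \<times> real \<Rightarrow> real"
  where "laplacian w =
    (\<lambda>(x, y). (deriv ^^ 2) (\<lambda>s. w (s, y)) x + (deriv ^^ 2) (\<lambda>t. w (x, t)) y)"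

definition laplace_beltrami ::
    "(real \<Rightarrow> real) \<Rightarrow> (real \<times> real \<Rightarrow> real) \<Rightarrow> real \<times> real \<Rightarrow> real"
  where "laplace_beltrami Q w = (\<lambda>(x, y). inverse (Q x) * laplacian w (x, y))"

definition eigenspace :: "(real \<Rightarrow> real) \<Rightarrow> real \<Rightarrow> (real \<times> real \<Rightarrow> real) set"
  where "eigenspace Q \<mu> =
    {w. smooth w \<and> torus_fun w \<and> (\<forall>p. - laplace_beltrami Q w p = \<mu> * w p)}"

definition eigenfunction :: "(real \<Rightarrow> real) \<Rightarrow> real \<Rightarrow> (real \<times> real \<Rightarrow> real) \<Rightarrow> bool"
  where "eigenfunction Q \<mu> w \<longleftrightarrow> w \<in> eigenspace Q \<mu> \<and> w \<noteq> 0"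

definition eigenvalue :: "(real \<Rightarrow> real) \<Rightarrow> real \<Rightarrow> bool"
  where "eigenvalue Q \<mu> \<longleftrightarrow> (\<exists>w. eigenfunction Q \<mu> w)"

text \<open>The number of eigenvalues \<open>\<le> \<mu>\<close>, counted with multiplicities. (By the spectral theorem,
  both the sum and the dimensions are finite for a smooth positive \<open>2\<pi>\<close>-periodic \<open>Q\<close>.)\<close>

definition eigenvalue_count :: "(real \<Rightarrow> real) \<Rightarrow> real \<Rightarrow> nat"
  where "eigenvalue_count Q \<mu> = (\<Sum>\<nu> | eigenvalue Q \<nu> \<and> \<nu> \<le> \<mu>. dim (eigenspace Q \<nu>))"

text \<open>The \<open>n\<close>-th entry, \<open>n \<ge> 1\<close>, of the list of eigenvalues in nondecreasing order with
  multiplicities.\<close>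

definition nth_eigenvalue :: "(real \<Rightarrow> real) \<Rightarrow> nat \<Rightarrow> real"
  where "nth_eigenvalue Q n = (LEAST \<mu>. n \<le> eigenvalue_count Q \<mu>)"


section \<open>The Extended Courant Property\<close>

definition L_space :: "(real \<Rightarrow> real) \<Rightarrow> nat \<Rightarrow> (real \<times> real \<Rightarrow> real) set"
  where "L_space Q n = span (\<Union>k\<in>{1..n}. {w. eigenfunction Q (nth_eigenvalue Q k) w})"

definition nodal_domains :: "(real \<times> real \<Rightarrow> real) \<Rightarrow> (complex \<times> complex) set set"
  where "nodal_domains w = components (torus_proj ` {p. w p \<noteq> 0})"

definition extended_courant_property :: "(real \<Rightarrow> real) \<Rightarrow> bool"
  where "extended_courant_property Q \<longleftrightarrow>
    (\<forall>n\<ge>1. \<forall>w \<in> L_space Q n. w \<noteq> 0 \<longrightarrow>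
       finite (nodal_domains w) \<and> card (nodal_domains w) \<le> n)"

end

theory Submission
  imports Defs "HOL-Computational_Algebra.Polynomial"
begin

text \<open>
  Choose a function \<open>F\<close> on the circle that is close to \<open>1\<close> and oscillates infinitely often around the
  value \<open>1\<close>, with amplitudes that decay so fast that \<open>F\<close> remains smooth, and put
  \<open>\<Phi> (x, y) = F x * cos y\<close>. The equation \<open>- \<Delta>\<^sub>0 \<Phi> = Q * \<Phi>\<close> then reads \<open>Q = 1 - F'' / F\<close>, which is a
  smooth positive function when \<open>F - 1\<close> is small together with its second derivative
  (\<open>Phi_eigenfunction\<close>). The set \<open>\<Phi> > 1\<close> contains a point with \<open>y = 0\<close> over each bump of \<open>F\<close> above the
  value \<open>1\<close>, and the circles over the points where \<open>F < 1\<close> are disjoint from it and separate these points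
  (\<open>superlevel_separation\<close>). Here \<open>F\<close> depends on \<open>x\<close> through \<open>sin x\<close>, so that periodicity is automatic, and
  the oscillation is modelled on \<open>exp (- 1 / t\<^sup>2) * sin (1 / t)\<close>.

  The function \<open>\<Phi> - 1\<close> is a combination of two eigenfunctions with infinitely many nodal domains. It
  contradicts the Extended Courant Property once it is known to lie in some \<open>L_space Q n\<close>, that is,
  once \<open>0\<close> and \<open>1\<close> occur in the list of eigenvalues. For this, the eigenvalues in a half-line bounded
  above must be finite in number, and the eigenspaces of finite dimension. Both follow for every
  smooth positive \<open>Q\<close> from one elementary observation
  (\<open>poincare_inequality\<close>, \<open>finite_of_low_energy_combinations\<close>): a function
  whose Dirichlet energy is at most \<open>\<mu>\<close> times its squared weighted norm vanishes if finitely many of its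
  integrals over vertical segments vanish. Combinations of eigenfunctions with eigenvalues up to \<open>\<mu>\<close>
  have this energy bound by Green's identity and orthogonality, and a family larger than the number
  of segments has a nontrivial combination with vanishing integrals.
\<close>


section \<open>Calculus of smooth functions\<close>

definition dir_deriv :: "'a::euclidean_space \<Rightarrow> ('a \<Rightarrow> 'b::euclidean_space) \<Rightarrow> 'a \<Rightarrow> 'b"
  where "dir_deriv v f = (\<lambda>x. frechet_derivative f (at x) v)"

lemma dir_deriv_eqI: "(f has_derivative f') (at x) \<Longrightarrow> dir_deriv v f x = f' v"
  by (simp add: dir_deriv_def frechet_derivative_at[symmetric])

lemma C_k_Suc: "C_k (Suc k) f \<longleftrightarrow> (\<forall>x. f differentiable (at x)) \<and> (\<forall>v. C_k k (dir_deriv v f))"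
  by (simp add: dir_deriv_def)

declare C_k.simps(2) [simp del]

lemma C_k_Suc_I:
  assumes "\<And>x. (f has_derivative f' x) (at x)" "\<And>v. C_k k (\<lambda>x. f' x v)"
  shows "C_k (Suc k) f"
proof -
  have "dir_deriv v f = (\<lambda>x. f' x v)" for v
    using assms(1) by (auto intro: dir_deriv_eqI)
  with assms show ?thesis
    by (auto simp: C_k_Suc differentiable_def)
qed

lemma C_k_continuous: "C_k k f \<Longrightarrow> continuous_on UNIV f"
  by (cases k) (auto simp: C_k_Suc intro: differentiable_imp_continuous_on
      simp: differentiable_on_def intro: differentiable_at_withinI)

lemma C_k_Suc_imp: "C_k (Suc k) f \<Longrightarrow> C_k k f"
proof (induction k arbitrary: f)
  case 0
  then show ?case using C_k_continuous by force
next
  case (Suc k)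
  then show ?case by (metis C_k_Suc)
qed

lemma C_k_has_derivative:
  "C_k (Suc k) f \<Longrightarrow> (f has_derivative (\<lambda>v. dir_deriv v f x)) (at x)"
  by (simp add: C_k_Suc dir_deriv_def flip: frechet_derivative_works)

lemma C_k_const [simp]: "C_k k (\<lambda>x. c)"
proof (induction k arbitrary: c)
  case (Suc k)
  show ?case by (rule C_k_Suc_I[where f' = "\<lambda>x v. 0"]) (auto intro: Suc)
qed simp

lemma C_k_bounded_linear: "bounded_linear f \<Longrightarrow> C_k k f"
proof (cases k)
  case (Suc k)
  assume "bounded_linear f"
  then show ?thesis unfolding Suc
    by (intro C_k_Suc_I[where f' = "\<lambda>x. f"]) (auto intro: bounded_linear_imp_has_derivative)
qed (auto simp: linear_continuous_on)

lemma C_k_add: "C_k k f \<Longrightarrow> C_k k g \<Longrightarrow> C_k k (\<lambda>x. f x + g x)"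
proof (induction k arbitrary: f g)
  case (Suc k)
  show ?case
    by (rule C_k_Suc_I[OF has_derivative_add[OF Suc.prems[THEN C_k_has_derivative]]])
      (use Suc in \<open>auto simp: C_k_Suc\<close>)
qed (simp add: continuous_on_add)

lemma C_k_mult:
  fixes f g :: "'a::euclidean_space \<Rightarrow> real"
  shows "C_k k f \<Longrightarrow> C_k k g \<Longrightarrow> C_k k (\<lambda>x. f x * g x)"
proof (induction k arbitrary: f g)
  case (Suc k)
  show ?case
    by (rule C_k_Suc_I[OF has_derivative_mult[OF Suc.prems[THEN C_k_has_derivative]]])
      (use Suc Suc.prems[THEN C_k_Suc_imp] in \<open>auto simp: C_k_Suc intro!: C_k_add\<close>)
qed (simp add: continuous_on_mult)

lemma C_k_has_real_derivative:
  fixes g :: "real \<Rightarrow> real"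
  assumes "C_k (Suc k) g"
  shows "(g has_field_derivative dir_deriv 1 g t) (at t)"
proof -
  note D = C_k_has_derivative[OF assms, of t]
  have "dir_deriv v g t = dir_deriv 1 g t * v" for v
    using linear_cmul[OF has_derivative_linear[OF D], of v 1] by simp
  then have "(\<lambda>v. dir_deriv v g t) = (*) (dir_deriv 1 g t)"
    by (rule ext)
  with D show ?thesis by (simp only: has_field_derivative_def)
qed

lemma C_k_compose:
  fixes f :: "'a::euclidean_space \<Rightarrow> real" and g :: "real \<Rightarrow> real"
  shows "C_k k g \<Longrightarrow> C_k k f \<Longrightarrow> C_k k (\<lambda>x. g (f x))"
proof (induction k arbitrary: g)
  case 0
  then show ?case by (auto intro: continuous_on_compose2)
next
  case (Suc k)
  have "((\<lambda>x. g (f x)) has_derivative (\<lambda>v. dir_deriv 1 g (f x) * dir_deriv v f x)) (at x)" for x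
    using has_derivative_compose[OF C_k_has_derivative[OF Suc.prems(2)]
        C_k_has_real_derivative[OF Suc.prems(1), unfolded has_field_derivative_def]] .
  moreover have "C_k k (\<lambda>x. dir_deriv 1 g (f x) * dir_deriv v f x)" for v
    using Suc.prems Suc.IH[of "dir_deriv 1 g"] C_k_Suc_imp[OF Suc.prems(2)]
    by (intro C_k_mult) (simp_all add: C_k_Suc)
  ultimately show ?case
    by (rule C_k_Suc_I)
qed

lemma C_k_inverse:
  fixes f :: "'a::euclidean_space \<Rightarrow> real"
  assumes "\<And>x. f x \<noteq> 0"
  shows "C_k k f \<Longrightarrow> C_k k (\<lambda>x. inverse (f x))"
proof (induction k)
  case 0
  then show ?case using assms by (simp add: continuous_on_inverse)
next
  case (Suc k)
  have "((\<lambda>x. inverse (f x)) has_derivative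
      (\<lambda>v. - (inverse (f x) * dir_deriv v f x * inverse (f x)))) (at x)" for x
    by (rule Deriv.has_derivative_inverse[OF assms C_k_has_derivative[OF Suc.prems]])
  then show ?case
  proof (rule C_k_Suc_I)
    fix v
    have "C_k k (\<lambda>x. (- 1) * (inverse (f x) * dir_deriv v f x * inverse (f x)))"
      using Suc.prems Suc.IH[OF C_k_Suc_imp[OF Suc.prems]]
      by (intro C_k_mult C_k_const) (simp_all add: C_k_Suc)
    then show "C_k k (\<lambda>x. - (inverse (f x) * dir_deriv v f x * inverse (f x)))" by simp
  qed
qed

text \<open>A class of functions of one real variable that is stable under differentiation consists of
  smooth functions. This is how concrete functions are shown to be smooth below, since it avoids
  computing their higher derivatives.\<close>

lemma C_k_of_derivatives:
  fixes S :: "(real \<Rightarrow> real) set"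
  assumes "\<And>f. f \<in> S \<Longrightarrow> \<exists>g\<in>S. \<forall>x. (f has_field_derivative g x) (at x)"
  shows "f \<in> S \<Longrightarrow> C_k k f"
proof (induction k arbitrary: f)
  case 0
  then obtain g where "\<And>x. (f has_field_derivative g x) (at x)"
    using assms by blast
  then show ?case
    by (metis C_k.simps(1) DERIV_isCont continuous_at_imp_continuous_on)
next
  case (Suc k)
  then obtain g where g: "g \<in> S" "\<And>x. (f has_field_derivative g x) (at x)"
    using assms by blast
  show ?case
    by (rule C_k_Suc_I[OF g(2)[unfolded has_field_derivative_def]])
      (rule C_k_mult[OF Suc.IH[OF g(1)] C_k_const])
qed

lemma smooth_const [simp]: "smooth (\<lambda>x. c)"
  by (simp add: smooth_def)

lemma smooth_bounded_linear: "bounded_linear f \<Longrightarrow> smooth f"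
  by (simp add: smooth_def C_k_bounded_linear)

lemma smooth_add: "smooth f \<Longrightarrow> smooth g \<Longrightarrow> smooth (\<lambda>x. f x + g x)"
  by (simp add: smooth_def C_k_add)

lemma smooth_mult:
  fixes f g :: "'a::euclidean_space \<Rightarrow> real"
  shows "smooth f \<Longrightarrow> smooth g \<Longrightarrow> smooth (\<lambda>x. f x * g x)"
  by (simp add: smooth_def C_k_mult)

lemma smooth_compose:
  fixes f :: "'a::euclidean_space \<Rightarrow> real" and g :: "real \<Rightarrow> real"
  shows "smooth g \<Longrightarrow> smooth f \<Longrightarrow> smooth (\<lambda>x. g (f x))"
  by (simp add: smooth_def C_k_compose)

lemma smooth_inverse:
  fixes f :: "'a::euclidean_space \<Rightarrow> real"
  shows "(\<And>x. f x \<noteq> 0) \<Longrightarrow> smooth f \<Longrightarrow> smooth (\<lambda>x. inverse (f x))"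
  by (simp add: smooth_def C_k_inverse)

lemma smooth_sum:
  "(\<And>i. i \<in> I \<Longrightarrow> smooth (f i)) \<Longrightarrow> smooth (\<lambda>x. \<Sum>i\<in>I. f i x)"
  by (induction I rule: infinite_finite_induct) (auto intro: smooth_add)

lemma smooth_of_derivatives:
  fixes S :: "(real \<Rightarrow> real) set"
  assumes "\<And>f. f \<in> S \<Longrightarrow> \<exists>g\<in>S. \<forall>x. (f has_field_derivative g x) (at x)" "f \<in> S"
  shows "smooth f"
  using C_k_of_derivatives[of S f] assms by (simp add: smooth_def)

lemma smooth_sin_cos: "smooth (sin :: real \<Rightarrow> real)" "smooth (cos :: real \<Rightarrow> real)"
proof -
  let ?S = "{\<lambda>x::real. a * sin x + b * cos x | a b. True}"
  have *: "\<exists>g\<in>?S. \<forall>x. (f has_field_derivative g x) (at x)" if "f \<in> ?S" for f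
  proof -
    from that obtain a b where f: "f = (\<lambda>x. a * sin x + b * cos x)" by auto
    have "(f has_field_derivative (- b) * sin x + a * cos x) (at x)" for x
      unfolding f by (auto intro!: derivative_eq_intros)
    moreover have "(\<lambda>x. (- b) * sin x + a * cos x) \<in> ?S" by blast
    ultimately show ?thesis by (metis (mono_tags, lifting))
  qed
  have "(\<lambda>x. 1 * sin x + 0 * cos x) \<in> ?S" "(\<lambda>x. 0 * sin x + 1 * cos x) \<in> ?S"
    by blast+
  moreover have "smooth f" if "f \<in> ?S" for f
    by (rule smooth_of_derivatives[OF _ that]) (rule *)
  ultimately have "smooth (\<lambda>x::real. 1 * sin x + 0 * cos x)" "smooth (\<lambda>x::real. 0 * sin x + 1 * cos x)"
    by blast+
  then show "smooth (sin :: real \<Rightarrow> real)" "smooth (cos :: real \<Rightarrow> real)" by simp_all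
qed

lemma smooth_dir_deriv: "smooth f \<Longrightarrow> smooth (dir_deriv v f)"
  by (simp add: smooth_def) (metis C_k_Suc)

lemma smooth_has_derivative: "smooth f \<Longrightarrow> (f has_derivative (\<lambda>v. dir_deriv v f x)) (at x)"
  by (rule C_k_has_derivative[of 0]) (simp add: smooth_def)

lemma smooth_continuous: "smooth f \<Longrightarrow> continuous_on S f"
  by (meson C_k_continuous continuous_on_subset smooth_def subset_UNIV)

lemma smooth_has_real_derivative:
  fixes f :: "real \<Rightarrow> real"
  shows "smooth f \<Longrightarrow> (f has_field_derivative dir_deriv 1 f x) (at x)"
  by (rule C_k_has_real_derivative[of 0]) (simp add: smooth_def)


section \<open>Integration by parts on the torus\<close>

lemma smooth_partial_derivatives:
  fixes f :: "real \<times> real \<Rightarrow> real"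
  assumes "smooth f"
  shows "((\<lambda>s. f (s, y)) has_field_derivative dir_deriv (1, 0) f (x, y)) (at x)"
    and "((\<lambda>t. f (x, t)) has_field_derivative dir_deriv (0, 1) f (x, y)) (at y)"
proof -
  note D = smooth_has_derivative[OF assms, of "(x, y)"]
  note lin = linear_cmul[OF has_derivative_linear[OF D]]
  have "dir_deriv (v, 0) f (x, y) = dir_deriv (1, 0) f (x, y) * v" for v
    using lin[of v "(1, 0)"] by simp
  then have 1: "(\<lambda>v. dir_deriv (v, 0) f (x, y)) = (*) (dir_deriv (1, 0) f (x, y))"
    by (rule ext)
  have "((\<lambda>s. (s, y)) has_derivative (\<lambda>v. (v, 0))) (at x)"
    by (auto intro!: derivative_eq_intros)
  from has_derivative_compose[OF this, of f] D
  show "((\<lambda>s. f (s, y)) has_field_derivative dir_deriv (1, 0) f (x, y)) (at x)"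
    by (simp add: has_field_derivative_def flip: 1)
  have "dir_deriv (0, v) f (x, y) = dir_deriv (0, 1) f (x, y) * v" for v
    using lin[of v "(0, 1)"] by simp
  then have 2: "(\<lambda>v. dir_deriv (0, v) f (x, y)) = (*) (dir_deriv (0, 1) f (x, y))"
    by (rule ext)
  have "((\<lambda>t. (x, t)) has_derivative (\<lambda>v. (0, v))) (at y)"
    by (auto intro!: derivative_eq_intros)
  from has_derivative_compose[OF this, of f] D
  show "((\<lambda>t. f (x, t)) has_field_derivative dir_deriv (0, 1) f (x, y)) (at y)"
    by (simp add: has_field_derivative_def flip: 2)
qed

lemma dir_deriv_mult:
  fixes f g :: "'a::euclidean_space \<Rightarrow> real"
  assumes "smooth f" "smooth g"
  shows "dir_deriv v (\<lambda>p. f p * g p) p = f p * dir_deriv v g p + dir_deriv v f p * g p"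
  by (rule dir_deriv_eqI[OF has_derivative_mult]) (rule smooth_has_derivative assms)+

lemma laplacian_smooth:
  assumes "smooth w"
  shows "laplacian w p = dir_deriv (1, 0) (dir_deriv (1, 0) w) p + dir_deriv (0, 1) (dir_deriv (0, 1) w) p"
proof -
  obtain x y where p: "p = (x, y)" by force
  note D = smooth_partial_derivatives[THEN DERIV_imp_deriv]
  have "deriv (\<lambda>s. w (s, y)) = (\<lambda>s. dir_deriv (1, 0) w (s, y))" "deriv (\<lambda>t. w (x, t)) = (\<lambda>t. dir_deriv (0, 1) w (x, t))"
    by (auto simp: D[OF assms])
  then show ?thesis
    unfolding p laplacian_def by (simp add: numeral_2_eq_2 D[OF smooth_dir_deriv[OF assms]])
qed

lemma torus_fun_dir_deriv:
  assumes "smooth f" "torus_fun f"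
  shows "torus_fun (dir_deriv v f)"
proof -
  have "dir_deriv v f (p + c) = dir_deriv v f p" if c: "\<And>p. f (p + c) = f p" for c p
  proof -
    have "((\<lambda>p. p + c) has_derivative (\<lambda>h. h)) (at p)"
      by (auto intro!: derivative_eq_intros)
    from has_derivative_compose[OF this smooth_has_derivative[OF assms(1)]]
    have "(f has_derivative (\<lambda>v. dir_deriv v f (p + c))) (at p)"
      by (simp add: c)
    from dir_deriv_eqI[OF this, of v] show ?thesis by simp
  qed
  from this[of "(2 * pi, 0)"] this[of "(0, 2 * pi)"] assms(2) show ?thesis
    by (auto simp: torus_fun_def)
qed

definition torus_integral :: "(real \<times> real \<Rightarrow> real) \<Rightarrow> real"
  where "torus_integral = integral (cbox (0, 0) (2 * pi, 2 * pi))"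

lemma torus_integral_iterated:
  assumes "continuous_on UNIV f"
  shows "torus_integral f = integral {0..2*pi} (\<lambda>x. integral {0..2*pi} (\<lambda>y. f (x, y)))"
    and "torus_integral f = integral {0..2*pi} (\<lambda>y. integral {0..2*pi} (\<lambda>x. f (x, y)))"
proof -
  have c: "continuous_on S f" for S using assms continuous_on_subset by blast
  show 1: "torus_integral f = integral {0..2*pi} (\<lambda>x. integral {0..2*pi} (\<lambda>y. f (x, y)))"
    using integral_prod_continuous[OF c] by (simp add: torus_integral_def)
  show "torus_integral f = integral {0..2*pi} (\<lambda>y. integral {0..2*pi} (\<lambda>x. f (x, y)))"
    unfolding 1 using integral_swap_continuous[of 0 0 "2*pi" "2*pi" "\<lambda>x y. f (x, y)"] c by simp
qed

lemma torus_integrable: "continuous_on UNIV f \<Longrightarrow> f integrable_on cbox (0, 0) (2 * pi, 2 * pi)"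
  for f :: "real \<times> real \<Rightarrow> real"
  by (meson continuous_on_subset integrable_continuous subset_UNIV)

lemma torus_integral_add:
  "continuous_on UNIV f \<Longrightarrow> continuous_on UNIV g \<Longrightarrow>
    torus_integral (\<lambda>p. f p + g p) = torus_integral f + torus_integral g"
  by (simp add: torus_integral_def integral_add torus_integrable)

lemma torus_integral_cmult: "torus_integral (\<lambda>p. c * f p) = c * torus_integral f"
  by (simp add: torus_integral_def)

lemma torus_integral_minus: "torus_integral (\<lambda>p. - f p) = - torus_integral f"
  by (simp add: torus_integral_def)

lemma torus_integral_sum:
  "finite I \<Longrightarrow> (\<And>i. i \<in> I \<Longrightarrow> continuous_on UNIV (f i)) \<Longrightarrow>
    torus_integral (\<lambda>p. \<Sum>i\<in>I. f i p) = (\<Sum>i\<in>I. torus_integral (f i))"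
  by (simp add: torus_integral_def integral_sum torus_integrable)

lemma torus_integral_mono:
  "continuous_on UNIV f \<Longrightarrow> continuous_on UNIV g \<Longrightarrow>
    (\<And>x y. x \<in> {0..2*pi} \<Longrightarrow> y \<in> {0..2*pi} \<Longrightarrow> f (x, y) \<le> g (x, y)) \<Longrightarrow>
    torus_integral f \<le> torus_integral g"
  unfolding torus_integral_def
  by (rule integral_le) (auto simp: torus_integrable)

lemma circle_fun_shift:
  assumes "circle_fun f"
  shows "f (x + 2 * pi * of_int n) = f x"
proof -
  have nat: "f (x + 2 * pi * of_nat m) = f x" for m x
  proof (induction m)
    case (Suc m)
    have "f (x + 2 * pi * of_nat (Suc m)) = f (x + 2 * pi * of_nat m + 2 * pi)"
      by (simp add: algebra_simps)
    with Suc assms show ?case by (simp add: circle_fun_def)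
  qed simp
  show ?thesis
  proof (cases n)
    case (nonneg m)
    then show ?thesis using nat[of x m] by simp
  next
    case (neg m)
    then have "real_of_int n = - real (Suc m)"
      by simp
    then have "x + 2 * pi * of_int n + 2 * pi * of_nat (Suc m) = x"
      by (simp add: algebra_simps del: of_nat_Suc)
    then show ?thesis using nat[of "x + 2 * pi * of_int n" "Suc m"] by metis
  qed
qed

lemma period_representative: "\<exists>t\<in>{0..2*pi}. \<exists>n. t = x + 2 * pi * of_int n"
proof -
  let ?n = "\<lfloor>x / (2 * pi)\<rfloor>"
  have "of_int ?n * (2 * pi) \<le> x" "x \<le> (of_int ?n + 1) * (2 * pi)"
    using floor_divide_lower[of "2 * pi" x] floor_divide_upper[of "2 * pi" x] by simp_all
  then have "x + 2 * pi * of_int (- ?n) \<in> {0..2*pi}"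
    by (simp add: algebra_simps)
  then show ?thesis by blast
qed

lemma torus_fun_representative:
  assumes "torus_fun f"
  shows "\<exists>s\<in>{0..2*pi}. \<exists>t\<in>{0..2*pi}. f (s, t) = f p"
proof -
  obtain x y where p: "p = (x, y)" by force
  obtain s m where s: "s \<in> {0..2*pi}" "s = x + 2 * pi * of_int m"
    using period_representative by blast
  obtain t n where t: "t \<in> {0..2*pi}" "t = y + 2 * pi * of_int n"
    using period_representative by blast
  have "circle_fun (\<lambda>x. f (x, t))" "circle_fun (\<lambda>y. f (x, y))"
    using assms by (auto simp: circle_fun_def torus_fun_def)
  from this[THEN circle_fun_shift] have "f (s, t) = f (x, y)"
    using s t by metis
  with s t p show ?thesis by blast
qed

lemma torus_integral_zero_imp_zero:
  assumes "continuous_on UNIV f" "torus_fun f" "\<And>p. f p \<ge> 0" "torus_integral f \<le> 0"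
  shows "f p = 0"
proof -
  have c: "continuous_on S f" for S using assms continuous_on_subset by blast
  have "torus_integral f \<ge> 0"
    unfolding torus_integral_def by (rule integral_nonneg) (auto simp: assms torus_integrable)
  with assms have "torus_integral f = 0" by simp
  moreover have "box (0, 0) (2 * pi, 2 * pi) \<noteq> ({} :: (real \<times> real) set)"
    by (auto simp: box_ne_empty Basis_prod_def)
  ultimately have "\<forall>q\<in>cbox (0, 0) (2 * pi, 2 * pi). f q = 0"
    using integral_cbox_eq_0_iff[OF c] assms(3) unfolding torus_integral_def by blast
  with torus_fun_representative[OF assms(2), of p] show ?thesis
    by force
qed

text \<open>A partial derivative of a periodic function integrates to zero along its own coordinate
  circle. All integrations by parts on the torus are instances of this.\<close>

lemma torus_integral_dir_deriv:
  assumes "smooth g" "torus_fun g"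
  shows "torus_integral (dir_deriv (1, 0) g) = 0" "torus_integral (dir_deriv (0, 1) g) = 0"
proof -
  note D = smooth_partial_derivatives[OF assms(1), THEN has_field_derivative_at_within,
      unfolded has_real_derivative_iff_has_vector_derivative]
  have c: "continuous_on UNIV (dir_deriv v g)" for v
    by (rule smooth_continuous[OF smooth_dir_deriv[OF assms(1)]])
  have "integral {0..2*pi} (\<lambda>x. dir_deriv (1, 0) g (x, y)) = 0" for y
    using fundamental_theorem_of_calculus[of 0 "2*pi", OF _ D(1)[of y]]
      assms(2)[unfolded torus_fun_def, rule_format, of 0 y]
    by (simp add: integral_unique)
  then show "torus_integral (dir_deriv (1, 0) g) = 0"
    by (simp add: torus_integral_iterated(2)[OF c])
  have "integral {0..2*pi} (\<lambda>y. dir_deriv (0, 1) g (x, y)) = 0" for x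
    using fundamental_theorem_of_calculus[of 0 "2*pi", OF _ D(2)[of x]]
      assms(2)[unfolded torus_fun_def, rule_format, of x 0]
    by (simp add: integral_unique)
  then show "torus_integral (dir_deriv (0, 1) g) = 0"
    by (simp add: torus_integral_iterated(1)[OF c])
qed

definition gradient_product :: "(real \<times> real \<Rightarrow> real) \<Rightarrow> (real \<times> real \<Rightarrow> real) \<Rightarrow> real \<times> real \<Rightarrow> real"
  where "gradient_product u v p = dir_deriv (1, 0) u p * dir_deriv (1, 0) v p + dir_deriv (0, 1) u p * dir_deriv (0, 1) v p"

lemma smooth_gradient_product: "smooth u \<Longrightarrow> smooth v \<Longrightarrow> smooth (gradient_product u v)"
  unfolding gradient_product_def by (intro smooth_add smooth_mult smooth_dir_deriv)

lemma smooth_laplacian: "smooth w \<Longrightarrow> smooth (laplacian w)"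
proof -
  assume w: "smooth w"
  then have "laplacian w = (\<lambda>p. dir_deriv (1, 0) (dir_deriv (1, 0) w) p + dir_deriv (0, 1) (dir_deriv (0, 1) w) p)"
    by (auto simp: laplacian_smooth)
  with w show ?thesis by (simp add: smooth_add smooth_dir_deriv)
qed

lemma greens_identity:
  assumes "smooth u" "torus_fun u" "smooth v" "torus_fun v"
  shows "torus_integral (\<lambda>p. u p * laplacian v p) = - torus_integral (gradient_product u v)"
proof -
  let ?d = "\<lambda>e p. dir_deriv e (\<lambda>p. u p * dir_deriv e v p) p"
  have sm: "smooth (\<lambda>p. u p * dir_deriv e v p)" for e
    by (intro smooth_mult smooth_dir_deriv assms)
  have t: "torus_fun (\<lambda>p. u p * dir_deriv e v p)" for e
    using torus_fun_dir_deriv[OF assms(3,4), of e] assms(2) by (auto simp: torus_fun_def)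
  have c: "continuous_on UNIV (?d e)" for e
    by (intro smooth_continuous smooth_dir_deriv sm)
  \<comment> \<open>The left integrand is the divergence of the periodic vector field \<open>u \<nabla>v\<close>.\<close>
  have "torus_integral (\<lambda>p. u p * laplacian v p + gradient_product u v p)
      = torus_integral (\<lambda>p. ?d (1, 0) p + ?d (0, 1) p)"
    by (simp add: laplacian_smooth assms gradient_product_def dir_deriv_mult smooth_dir_deriv algebra_simps)
  also have "\<dots> = 0"
    using torus_integral_dir_deriv[OF sm t] by (simp add: torus_integral_add c)
  finally show ?thesis
    using assms by (simp add: torus_integral_add smooth_continuous smooth_mult smooth_laplacian
        smooth_gradient_product)
qed


section \<open>Functions of low energy with vanishing segment integrals\<close>

text \<open>The case of the Cauchy-Schwarz inequality with the constant function \<open>1\<close>: the variance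
  of \<open>f\<close> on the interval is nonnegative.\<close>

lemma integral_cauchy_schwarz:
  fixes f :: "real \<Rightarrow> real"
  assumes "continuous_on {a..b} f" "a \<le> b"
  shows "(integral {a..b} f)\<^sup>2 \<le> (b - a) * integral {a..b} (\<lambda>x. (f x)\<^sup>2)"
proof (cases "a = b")
  case False
  define m where "m = integral {a..b} f / (b - a)"
  have int: "f integrable_on {a..b}" "(\<lambda>x. (f x)\<^sup>2) integrable_on {a..b}"
    by (intro integrable_continuous_real continuous_intros assms)+
  have "0 \<le> integral {a..b} (\<lambda>x. (f x - m)\<^sup>2)"
    by (intro integral_nonneg integrable_continuous_real continuous_intros assms) auto
  also have "(\<lambda>x. (f x - m)\<^sup>2) = (\<lambda>x. (f x)\<^sup>2 + ((- 2 * m) * f x + m\<^sup>2))"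
    by (auto simp: power2_eq_square algebra_simps)
  also have "integral {a..b} \<dots> = integral {a..b} (\<lambda>x. (f x)\<^sup>2) + ((- 2 * m) * integral {a..b} f + (b - a) * m\<^sup>2)"
    using has_integral_add[OF integrable_integral[OF int(2)] has_integral_add[OF
        has_integral_mult_right[OF integrable_integral[OF int(1)], of "- 2 * m"]
        has_integral_const_real[of "m\<^sup>2" a b]]] assms(2)
    by (simp add: integral_unique)
  also have "integral {a..b} f = m * (b - a)"
    using False by (simp add: m_def)
  finally have "m\<^sup>2 * (b - a) \<le> integral {a..b} (\<lambda>x. (f x)\<^sup>2)"
    by (simp add: power2_eq_square algebra_simps)
  then have "(b - a) * (m\<^sup>2 * (b - a)) \<le> (b - a) * integral {a..b} (\<lambda>x. (f x)\<^sup>2)"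
    using assms(2) by (intro mult_left_mono) auto
  then show ?thesis
    using False by (simp add: m_def power2_eq_square)
qed simp

lemma increment_bound:
  fixes g :: "real \<Rightarrow> real"
  assumes D: "\<And>t. (g has_field_derivative g' t) (at t)" and c: "continuous_on UNIV g'"
    and "u \<in> {a..b}" "v \<in> {a..b}"
  shows "(g u - g v)\<^sup>2 \<le> \<bar>u - v\<bar> * integral {a..b} (\<lambda>t. (g' t)\<^sup>2)"
proof -
  have c: "continuous_on S g'" for S using c continuous_on_subset by blast
  have *: "(g v - g u)\<^sup>2 \<le> (v - u) * integral {a..b} (\<lambda>t. (g' t)\<^sup>2)"
    if "u \<le> v" "u \<in> {a..b}" "v \<in> {a..b}" for u v
  proof -
    have "g v - g u = integral {u..v} g'"
      using fundamental_theorem_of_calculus[OF that(1), of g g']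
        has_field_derivative_at_within[OF D]
      by (simp add: has_real_derivative_iff_has_vector_derivative integral_unique)
    then have "(g v - g u)\<^sup>2 \<le> (v - u) * integral {u..v} (\<lambda>t. (g' t)\<^sup>2)"
      using integral_cauchy_schwarz[OF c that(1)] by simp
    also have "\<dots> \<le> (v - u) * integral {a..b} (\<lambda>t. (g' t)\<^sup>2)"
      using that by (intro mult_left_mono integral_subset_le integrable_continuous_real
          continuous_intros c) auto
    finally show ?thesis .
  qed
  show ?thesis
    using *[of u v] *[of v u] assms(3,4) by (cases "u \<le> v") (auto simp: power2_commute)
qed

lemma grid_cell:
  fixes x :: real and N :: nat
  assumes "N > 0" "x \<in> {0..a}" "a > 0"
  shows "\<exists>j<N. x \<in> {a / N * real j..a / N * (real j + 1)}"
proof (cases "x = a")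
  case True
  then show ?thesis using assms
    by (intro exI[of _ "N - 1"]) (auto simp: of_nat_diff field_simps)
next
  case False
  let ?j = "nat \<lfloor>x * N / a\<rfloor>"
  have nn: "0 \<le> x * N / a" and lt: "x * N / a < N"
    using assms False by (auto simp: field_simps)
  then have j: "real ?j \<le> x * N / a" "x * N / a < real ?j + 1"
    by linarith+
  then have "real ?j < real N" using lt by linarith
  moreover have "x \<in> {a / N * real ?j..a / N * (real ?j + 1)}"
    using j assms by (simp add: field_simps)
  ultimately show ?thesis by auto
qed

text \<open>The finitely many linear functionals that detect functions of low energy: integrals over
  vertical segments. There are \<open>K\<close> segments above each of \<open>K\<^sup>2\<close> equally spaced abscissas. The spacing
  of the abscissas has to be of smaller order than the length \<open>2 * pi / K\<close> of the segments, because
  replacing a value of a function by its mean over a segment divides an integral by that length.\<close>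

definition segment_integral :: "nat \<Rightarrow> nat \<times> nat \<Rightarrow> (real \<times> real \<Rightarrow> real) \<Rightarrow> real"
  where "segment_integral K jk w =
    integral {2 * pi / K * real (snd jk)..2 * pi / K * (real (snd jk) + 1)}
      (\<lambda>y. w (2 * pi / real (K\<^sup>2) * real (fst jk), y))"

lemma continuous_on_slices:
  assumes "continuous_on UNIV (f :: real \<times> real \<Rightarrow> real)"
  shows "continuous_on S (\<lambda>y. f (x, y))" "continuous_on S (\<lambda>x. f (x, y))"
  by (rule continuous_on_compose2[OF assms], auto intro!: continuous_intros)+

lemma continuous_on_slice_integral:
  assumes "continuous_on UNIV (f :: real \<times> real \<Rightarrow> real)"
  shows "continuous_on S (\<lambda>x. integral {a..b} (\<lambda>y. f (x, y)))"
    and "continuous_on S (\<lambda>y. integral {a..b} (\<lambda>x. f (x, y)))"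
proof -
  have c: "continuous_on S f" for S using assms continuous_on_subset by blast
  show "continuous_on S (\<lambda>x. integral {a..b} (\<lambda>y. f (x, y)))"
    using integral_continuous_on_param[of S a b "\<lambda>x y. f (x, y)"] c by simp
  have "continuous_on UNIV (\<lambda>(y, x). f (x, y))"
    unfolding case_prod_beta by (rule continuous_on_compose2[OF assms]) (auto intro!: continuous_intros)
  then show "continuous_on S (\<lambda>y. integral {a..b} (\<lambda>x. f (x, y)))"
    using integral_continuous_on_param[of S a b "\<lambda>y x. f (x, y)"] continuous_on_subset
    by (metis box_real(2) subset_UNIV)
qed

text \<open>In two dimensions point values are not controlled by the Dirichlet energy, but the following
  mixture of a point value in \<open>x\<close> and a mean value in \<open>y\<close> is. Compare \<open>w (x, y)\<close> with the mean of \<open>w\<close>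
  over the segment at the height of \<open>y\<close> above an abscissa \<open>z\<close> close to \<open>x\<close>, which is zero:
  first move vertically from \<open>y\<close> to a point \<open>t\<close> of the segment, at a cost given by the energy in direction \<open>y\<close> on the line through \<open>x\<close>; then
  move horizontally from \<open>x\<close> to \<open>z\<close>, at a cost given by the energy in direction \<open>x\<close> on the line through
  \<open>t\<close>; and average over \<open>t\<close>.\<close>

lemma pointwise_bound_of_vanishing_segment_integrals:
  assumes w: "smooth w" and K: "K > 0"
    and zero: "\<And>j k. j < K\<^sup>2 \<Longrightarrow> k < K \<Longrightarrow> segment_integral K (j, k) w = 0"
    and x: "x \<in> {0..2*pi}" and y: "y \<in> {0..2*pi}"
  shows "(w (x, y))\<^sup>2 \<le> 4 * pi / K * integral {0..2*pi} (\<lambda>t. (dir_deriv (0, 1) w (x, t))\<^sup>2)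
           + 2 / K * torus_integral (\<lambda>p. (dir_deriv (1, 0) w p)\<^sup>2)"
proof -
  have cpd: "continuous_on UNIV (dir_deriv v w)" for v
    by (rule smooth_continuous[OF smooth_dir_deriv[OF w]])
  have cpd2: "continuous_on UNIV (\<lambda>p. (dir_deriv v w p)\<^sup>2)" for v
    by (intro continuous_intros cpd)
  have cw: "continuous_on UNIV w" by (rule smooth_continuous[OF w])
  define d where "d = 2 * pi / K"
  have d: "d > 0" "2 * pi / real (K\<^sup>2) = d / K" using K by (auto simp: d_def power2_eq_square)
  define A where "A = integral {0..2*pi} (\<lambda>t. (dir_deriv (0, 1) w (x, t))\<^sup>2)"
  define C where "C t = integral {0..2*pi} (\<lambda>s. (dir_deriv (1, 0) w (s, t))\<^sup>2)" for t
  have cC: "continuous_on S C" for S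
    unfolding C_def by (rule continuous_on_slice_integral(2)[OF cpd2])
  have C0: "C t \<ge> 0" for t
    unfolding C_def by (intro integral_nonneg integrable_continuous_real continuous_on_slices(2)[OF cpd2]) auto
  have A0: "A \<ge> 0"
    unfolding A_def by (intro integral_nonneg integrable_continuous_real continuous_on_slices(1)[OF cpd2]) auto
  obtain k where k: "k < K" "y \<in> {d * real k..d * (real k + 1)}"
    using grid_cell[OF K y] unfolding d_def by auto
  obtain j where j: "j < K\<^sup>2" "x \<in> {d / K * real j..d / K * (real j + 1)}"
    using grid_cell[of "K\<^sup>2" x "2*pi"] K x unfolding d by auto
  define z where "z = d / K * real j"
  let ?I = "{d * real k..d * (real k + 1)}"
  have len: "d * (real k + 1) - d * real k = d" by (simp add: algebra_simps)
  have le: "d * real k \<le> d * (real k + 1)" using d by simp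
  have I: "?I \<subseteq> {0..2*pi}"
  proof -
    have "d * (real k + 1) \<le> d * K" using k d by (intro mult_left_mono) auto
    also have "\<dots> = 2 * pi" using K by (simp add: d_def)
    finally show ?thesis using d by auto
  qed
  have zx: "z \<in> {0..2*pi}" "\<bar>x - z\<bar> \<le> d / K"
    using j x d K by (auto simp: z_def algebra_simps add_divide_distrib)
  have ws: "continuous_on S (\<lambda>t. w (s, t))" for s S by (rule continuous_on_slices(1)[OF cw])
  have z0: "integral ?I (\<lambda>t. w (z, t)) = 0"
    using zero[OF j(1) k(1)] unfolding segment_integral_def d z_def by (simp add: d_def)
  let ?f = "\<lambda>t. w (x, y) - w (z, t)"
  have "d * w (x, y) = integral ?I ?f"
    using z0 le len by (simp add: integral_diff integrable_continuous_real ws)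
  then have "(d * w (x, y))\<^sup>2 \<le> d * integral ?I (\<lambda>t. (?f t)\<^sup>2)"
    using integral_cauchy_schwarz[of "d * real k" "d * (real k + 1)" ?f] le len
    by (simp add: continuous_intros ws)
  also have "integral ?I (\<lambda>t. (?f t)\<^sup>2) \<le> integral ?I (\<lambda>t. 2 * d * A + 2 * (d / K) * C t)"
  proof (rule integral_le)
    fix t assume t: "t \<in> ?I"
    have "(w (x, y) - w (x, t))\<^sup>2 \<le> \<bar>y - t\<bar> * A"
      unfolding A_def using t I y
      by (intro increment_bound smooth_partial_derivatives(2)[OF w] continuous_on_slices(1)[OF cpd]) auto
    also have "\<dots> \<le> d * A"
      using t k len A0 by (intro mult_right_mono) auto
    finally have 1: "(w (x, y) - w (x, t))\<^sup>2 \<le> d * A" .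
    have "(w (x, t) - w (z, t))\<^sup>2 \<le> \<bar>x - z\<bar> * C t"
      unfolding C_def using zx x
      by (intro increment_bound[where g = "\<lambda>s. w (s, t)"] smooth_partial_derivatives(1)[OF w] continuous_on_slices(2)[OF cpd]) auto
    also have "\<dots> \<le> d / K * C t"
      using zx C0 by (intro mult_right_mono) auto
    finally have 2: "(w (x, t) - w (z, t))\<^sup>2 \<le> d / K * C t" .
    have "(?f t)\<^sup>2 \<le> 2 * (w (x, y) - w (x, t))\<^sup>2 + 2 * (w (x, t) - w (z, t))\<^sup>2"
      using sum_squares_bound[of "w (x, y) - w (x, t)" "w (x, t) - w (z, t)"]
      by (simp add: power2_eq_square algebra_simps)
    with 1 2 show "(?f t)\<^sup>2 \<le> 2 * d * A + 2 * (d / K) * C t" by linarith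
  qed (intro integrable_continuous_real continuous_intros ws cC)+
  also have "\<dots> = 2 * d * A * d + 2 * (d / K) * integral ?I C"
    using has_integral_add[OF has_integral_const_real[of "2 * d * A" "d * real k" "d * (real k + 1)"]
        has_integral_mult_right[OF integrable_integral[OF integrable_continuous_real[OF cC]], of "2 * (d / K)"]]
      le len by (simp add: integral_unique mult.commute)
  also have "integral ?I C \<le> integral {0..2*pi} C"
    using I C0 by (intro integral_subset_le integrable_continuous_real cC) auto
  also have "integral {0..2*pi} C = torus_integral (\<lambda>p. (dir_deriv (1, 0) w p)\<^sup>2)" (is "_ = ?B")
    unfolding C_def by (rule torus_integral_iterated(2)[OF cpd2, symmetric])
  finally have "d\<^sup>2 * (w (x, y))\<^sup>2 \<le> d\<^sup>2 * (2 * d * A + 2 / K * ?B)"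
    using d by (simp add: power2_eq_square algebra_simps mult_left_mono divide_right_mono)
  then have "(w (x, y))\<^sup>2 \<le> 2 * d * A + 2 / K * ?B"
    using d(1) by (simp only: mult_le_cancel_left_pos zero_less_power)
  then show ?thesis
    by (simp add: A_def d_def)
qed

text \<open>What matters about the constant is that it tends to zero as \<open>K\<close> grows.\<close>

lemma poincare_inequality:
  assumes w: "smooth w" and K: "K > 0"
    and zero: "\<And>j k. j < K\<^sup>2 \<Longrightarrow> k < K \<Longrightarrow> segment_integral K (j, k) w = 0"
  shows "torus_integral (\<lambda>p. (w p)\<^sup>2) \<le> 8 * pi\<^sup>2 / K * torus_integral (gradient_product w w)"
proof -
  have cpd2: "continuous_on UNIV (\<lambda>p. (dir_deriv v w p)\<^sup>2)" for v
    by (intro continuous_intros smooth_continuous smooth_dir_deriv w)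
  define A where "A x = integral {0..2*pi} (\<lambda>t. (dir_deriv (0, 1) w (x, t))\<^sup>2)" for x
  have cA: "continuous_on S A" for S
    unfolding A_def by (rule continuous_on_slice_integral(1)[OF cpd2])
  define B where "B = torus_integral (\<lambda>p. (dir_deriv (1, 0) w p)\<^sup>2)"
  have c: "continuous_on UNIV (\<lambda>p::real \<times> real. 4 * pi / K * A (fst p) + 2 / K * B)"
    by (intro continuous_intros continuous_on_compose2[OF cA[of UNIV]]) auto
  have "torus_integral (\<lambda>p. (w p)\<^sup>2) \<le> torus_integral (\<lambda>p. 4 * pi / K * A (fst p) + 2 / K * B)"
    by (rule torus_integral_mono[OF _ c])
      (use pointwise_bound_of_vanishing_segment_integrals[OF assms] in
        \<open>auto simp: A_def B_def intro!: continuous_on_power smooth_continuous[OF w]\<close>)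
  also have "\<dots> = integral {0..2*pi} (\<lambda>x. 2 * pi * (4 * pi / K) * A x + 2 * pi * (2 / K * B))"
    unfolding torus_integral_iterated(1)[OF c] by (simp add: algebra_simps)
  also have "\<dots> = 2 * pi * (4 * pi / K) * integral {0..2*pi} A + 2 * pi * (2 * pi * (2 / K * B))"
    using has_integral_add[OF has_integral_mult_right[OF integrable_integral[OF
          integrable_continuous_real[OF cA]], of "2 * pi * (4 * pi / K)"]
        has_integral_const_real[of "2 * pi * (2 / K * B)" 0 "2 * pi"]]
    by (simp add: integral_unique)
  also have "integral {0..2*pi} A = torus_integral (\<lambda>p. (dir_deriv (0, 1) w p)\<^sup>2)"
    unfolding A_def by (rule torus_integral_iterated(1)[OF cpd2, symmetric])
  also have "2 * pi * (4 * pi / K) * \<dots> + 2 * pi * (2 * pi * (2 / K * B))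
      = 8 * pi\<^sup>2 / K * torus_integral (\<lambda>p. (dir_deriv (1, 0) w p)\<^sup>2 + (dir_deriv (0, 1) w p)\<^sup>2)"
    unfolding torus_integral_add[OF cpd2 cpd2] B_def by (simp add: power2_eq_square algebra_simps)
  finally show ?thesis
    by (simp add: gradient_product_def[abs_def] power2_eq_square)
qed


section \<open>Finiteness of the spectrum below a bound\<close>

text \<open>A homogeneous linear system with more unknowns than equations, indexed by arbitrary finite
  sets. The induction eliminates the unknown \<open>k\<close> by means of the equation \<open>a\<close>.\<close>

lemma homogeneous_system_nontrivial_solution:
  fixes m :: "'e \<Rightarrow> 'i \<Rightarrow> real"
  assumes "finite E" "finite I" "card E < card I"
  shows "\<exists>c. (\<exists>i\<in>I. c i \<noteq> 0) \<and> (\<forall>e\<in>E. (\<Sum>i\<in>I. c i * m e i) = 0)"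
  using assms
proof (induction E arbitrary: I m rule: finite_induct)
  case empty
  then obtain i where "i \<in> I" by fastforce
  then show ?case by (intro exI[of _ "\<lambda>_. 1"]) auto
next
  case (insert a E)
  show ?case
  proof (cases "\<forall>i\<in>I. m a i = 0")
    case True
    have "card E < card I" using insert by simp
    from insert.IH[OF insert.prems(1) this, of m] True show ?thesis
      by auto
  next
    case False
    then obtain k where k: "k \<in> I" "m a k \<noteq> 0" by blast
    have "card E < card (I - {k})"
      using insert k by simp
    from insert.IH[OF _ this, of "\<lambda>e i. m e i - m a i / m a k * m e k"] insert.prems obtain c where
      c: "\<exists>i\<in>I - {k}. c i \<noteq> 0"
        "\<And>e. e \<in> E \<Longrightarrow> (\<Sum>i\<in>I - {k}. c i * (m e i - m a i / m a k * m e k)) = 0"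
      by auto
    define ck where "ck = - (\<Sum>i\<in>I - {k}. c i * m a i) / m a k"
    have sum: "(\<Sum>i\<in>I. (c(k := ck)) i * m e i) = ck * m e k + (\<Sum>i\<in>I - {k}. c i * m e i)" for e
      using k insert.prems by (subst sum.remove[of I k]) (auto intro!: sum.cong)
    have "(\<Sum>i\<in>I. (c(k := ck)) i * m e i) = 0" if e: "e \<in> insert a E" for e
    proof (cases "e = a")
      case True
      then show ?thesis unfolding sum using k by (simp add: ck_def)
    next
      case False
      with e have "e \<in> E" by simp
      from c(2)[OF this] show ?thesis unfolding sum
        by (simp add: ck_def algebra_simps sum_subtractf sum_distrib_left sum_distrib_right sum_divide_distrib)
    qed
    moreover have "\<exists>i\<in>I. (c(k := ck)) i \<noteq> 0" using c(1) by auto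
    ultimately show ?thesis by blast
  qed
qed

definition conformal_factor :: "(real \<Rightarrow> real) \<Rightarrow> bool"
  where "conformal_factor Q \<longleftrightarrow> smooth Q \<and> circle_fun Q \<and> (\<forall>x. Q x > 0)"

lemma conformal_factor_smooth: "conformal_factor Q \<Longrightarrow> smooth (\<lambda>p :: real \<times> real. Q (fst p))"
  by (rule smooth_compose[of Q fst])
    (simp_all add: conformal_factor_def smooth_bounded_linear bounded_linear_fst)

lemma eigenspaceD:
  assumes "conformal_factor Q" "w \<in> eigenspace Q \<nu>"
  shows "smooth w" "torus_fun w" "laplacian w p = - \<nu> * Q (fst p) * w p"
proof -
  show "smooth w" "torus_fun w" using assms by (auto simp: eigenspace_def)
  obtain x y where p: "p = (x, y)" by force
  have "- (inverse (Q x) * laplacian w (x, y)) = \<nu> * w (x, y)"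
    using assms unfolding eigenspace_def by (auto simp: laplace_beltrami_def)
  moreover have "Q x > 0" using assms by (simp add: conformal_factor_def)
  ultimately show "laplacian w p = - \<nu> * Q (fst p) * w p"
    by (simp add: p field_simps)
qed

lemma smooth_lincomb:
  fixes u :: "'i \<Rightarrow> 'a::euclidean_space \<Rightarrow> real"
  assumes "\<And>i. i \<in> I \<Longrightarrow> smooth (u i)"
  shows "smooth (\<lambda>p. \<Sum>i\<in>I. c i * u i p)"
  using assms by (intro smooth_sum smooth_mult smooth_const)

lemma torus_fun_lincomb:
  assumes "\<And>i. i \<in> I \<Longrightarrow> torus_fun (u i)"
  shows "torus_fun (\<lambda>p. \<Sum>i\<in>I. c i * u i p)"
  using assms by (auto simp: torus_fun_def intro!: sum.cong)

lemma laplacian_lincomb: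
  fixes u :: "'i \<Rightarrow> real \<times> real \<Rightarrow> real"
  assumes "\<And>i. i \<in> I \<Longrightarrow> smooth (u i)"
  shows "laplacian (\<lambda>p. \<Sum>i\<in>I. c i * u i p) p = (\<Sum>i\<in>I. c i * laplacian (u i) p)"
proof -
  have dir_deriv: "dir_deriv e (\<lambda>p. \<Sum>i\<in>I. c i * v i p) = (\<lambda>p. \<Sum>i\<in>I. c i * dir_deriv e (v i) p)"
    if "\<And>i. i \<in> I \<Longrightarrow> smooth (v i)" for e and v :: "'i \<Rightarrow> real \<times> real \<Rightarrow> real"
    by (rule ext, rule dir_deriv_eqI, intro has_derivative_sum has_derivative_mult_right smooth_has_derivative that)
  show ?thesis
    by (simp add: laplacian_smooth smooth_lincomb assms dir_deriv smooth_dir_deriv sum.distrib distrib_left)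
qed

lemma segment_integral_lincomb:
  assumes "finite I" "\<And>i. i \<in> I \<Longrightarrow> smooth (u i)"
  shows "segment_integral K jk (\<lambda>p. \<Sum>i\<in>I. c i * u i p) = (\<Sum>i\<in>I. c i * segment_integral K jk (u i))"
proof -
  have "continuous_on S (\<lambda>y. u i (x, y))" if "i \<in> I" for S i x
    using continuous_on_slices(1) smooth_continuous assms(2)[OF that] by blast
  then show ?thesis
    unfolding segment_integral_def using assms(1)
    by (subst integral_sum) (auto intro!: integrable_continuous_real continuous_intros)
qed

text \<open>The operator \<open>\<Delta>\<^sub>0 / Q\<close> is symmetric for the measure \<open>Q dx dy\<close>.\<close>

lemma orthogonality:
  assumes Q: "conformal_factor Q" and u: "u \<in> eigenspace Q \<nu>" and v: "v \<in> eigenspace Q \<nu>'"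
    and ne: "\<nu> \<noteq> \<nu>'"
  shows "torus_integral (\<lambda>p. Q (fst p) * (u p * v p)) = 0"
proof -
  note U = eigenspaceD[OF Q u] and V = eigenspaceD[OF Q v]
  have uv: "(\<lambda>p. u p * laplacian v p) = (\<lambda>p. - \<nu>' * (Q (fst p) * (u p * v p)))"
    and vu: "(\<lambda>p. v p * laplacian u p) = (\<lambda>p. - \<nu> * (Q (fst p) * (u p * v p)))"
    by (rule ext, simp add: V(3) U(3))+
  have "- \<nu>' * torus_integral (\<lambda>p. Q (fst p) * (u p * v p)) = torus_integral (\<lambda>p. u p * laplacian v p)"
    unfolding uv by (rule torus_integral_cmult[symmetric])
  also have "\<dots> = torus_integral (\<lambda>p. v p * laplacian u p)"
    unfolding greens_identity[OF U(1,2) V(1,2)] greens_identity[OF V(1,2) U(1,2)]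
    by (simp add: gradient_product_def[abs_def] mult.commute)
  also have "\<dots> = - \<nu> * torus_integral (\<lambda>p. Q (fst p) * (u p * v p))"
    unfolding vu by (rule torus_integral_cmult)
  finally show ?thesis using ne by simp
qed

text \<open>Since \<open>Q\<close> is bounded on the torus, the Poincare inequality beats any prescribed bound \<open>\<mu>\<close> on the
  Rayleigh quotient as soon as \<open>K\<close> is large.\<close>

lemma low_energy_determined_by_segment_integrals:
  assumes Q: "conformal_factor Q"
  shows "\<exists>K. \<forall>w. smooth w \<longrightarrow> torus_fun w \<longrightarrow>
     torus_integral (gradient_product w w) \<le> \<mu> * torus_integral (\<lambda>p. Q (fst p) * (w p)\<^sup>2) \<longrightarrow>
     (\<forall>jk\<in>{..<K\<^sup>2} \<times> {..<K}. segment_integral K jk w = 0) \<longrightarrow> (\<forall>p. w p = 0)"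
proof -
  have cQ: "continuous_on S Q" for S
    using Q by (simp add: conformal_factor_def smooth_continuous)
  have "\<exists>x\<in>{0..2*pi}. \<forall>y\<in>{0..2*pi}. Q y \<le> Q x"
    by (rule continuous_attains_sup) (auto simp: cQ)
  then obtain a where a: "\<And>x. x \<in> {0..2*pi} \<Longrightarrow> Q x \<le> Q a" by blast
  define M where "M = Q a"
  have M: "\<And>x. x \<in> {0..2*pi} \<Longrightarrow> Q x \<le> M" "M > 0"
    using a Q by (simp_all add: conformal_factor_def M_def)
  obtain K :: nat where K: "8 * pi\<^sup>2 * (max \<mu> 1) * M < K"
    using reals_Archimedean2 by blast
  have "0 < 8 * pi\<^sup>2 * (max \<mu> 1) * M" using M by simp
  with K have K0: "K > 0" by (metis less_trans of_nat_0_less_iff)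
  define r where "r = 8 * pi\<^sup>2 * (max \<mu> 1) * M / K"
  have r: "r < 1" using K K0 by (simp add: r_def)
  have "w p = 0" if w: "smooth w" "torus_fun w" and
    E: "torus_integral (gradient_product w w) \<le> \<mu> * torus_integral (\<lambda>p. Q (fst p) * (w p)\<^sup>2)"
    and Z: "\<forall>jk\<in>{..<K\<^sup>2} \<times> {..<K}. segment_integral K jk w = 0" for w p
  proof -
    have cw: "continuous_on UNIV (\<lambda>p. (w p)\<^sup>2)"
      by (intro continuous_intros smooth_continuous w)
    have cQw: "continuous_on UNIV (\<lambda>p. Q (fst p) * (w p)\<^sup>2)"
      by (intro continuous_intros cw smooth_continuous conformal_factor_smooth Q)
    let ?S = "torus_integral (\<lambda>p. Q (fst p) * (w p)\<^sup>2)"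
    have S0: "?S \<ge> 0"
      unfolding torus_integral_def using Q
      by (intro integral_nonneg torus_integrable cQw) (auto simp: conformal_factor_def less_imp_le)
    have "?S \<le> torus_integral (\<lambda>p. M * (w p)\<^sup>2)"
      by (rule torus_integral_mono[OF cQw]) (auto intro!: continuous_intros cw mult_right_mono M)
    also have "\<dots> \<le> M * (8 * pi\<^sup>2 / K * torus_integral (gradient_product w w))"
      unfolding torus_integral_cmult using M K0 Z
      by (intro mult_left_mono poincare_inequality w) auto
    also have "\<dots> \<le> M * (8 * pi\<^sup>2 / K * (max \<mu> 1 * ?S))"
      using M S0 by (intro mult_left_mono order_trans[OF E] mult_right_mono) auto
    also have "\<dots> = r * ?S" by (simp add: r_def)
    finally have "(1 - r) * ?S \<le> 0" by (simp add: algebra_simps)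
    with r have "?S \<le> 0" by (simp add: mult_le_0_iff)
    moreover have "torus_fun (\<lambda>p. Q (fst p) * (w p)\<^sup>2)"
      using Q w(2) by (auto simp: conformal_factor_def circle_fun_def torus_fun_def)
    ultimately have "Q (fst p) * (w p)\<^sup>2 = 0"
      using Q by (intro torus_integral_zero_imp_zero[OF cQw]) (auto simp: conformal_factor_def less_imp_le)
    then show ?thesis using Q by (auto simp: conformal_factor_def less_le)
  qed
  then show ?thesis by blast
qed

text \<open>A substitute for the spectral theorem. The functions of Rayleigh quotient at most \<open>\<mu>\<close> in a linear
  space are determined by finitely many linear functionals, hence a linearly independent family all
  of whose combinations have Rayleigh quotient at most \<open>\<mu>\<close> cannot have more members than there are
  functionals. It is applied to a basis of one eigenspace and to a choice of one eigenfunction for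
  each eigenvalue up to \<open>\<mu>\<close>.\<close>

lemma finite_of_low_energy_combinations:
  fixes u :: "'i \<Rightarrow> real \<times> real \<Rightarrow> real"
  assumes Q: "conformal_factor Q"
    and u: "\<And>i. i \<in> I \<Longrightarrow> smooth (u i)" "\<And>i. i \<in> I \<Longrightarrow> torus_fun (u i)"
    and energy: "\<And>F c w. \<lbrakk>finite F; F \<subseteq> I; w = (\<lambda>p. \<Sum>i\<in>F. c i * u i p)\<rbrakk> \<Longrightarrow>
      torus_integral (gradient_product w w) \<le> \<mu> * torus_integral (\<lambda>p. Q (fst p) * (w p)\<^sup>2)"
    and indep: "\<And>F c. \<lbrakk>finite F; F \<subseteq> I; \<And>p. (\<Sum>i\<in>F. c i * u i p) = 0\<rbrakk> \<Longrightarrow> \<forall>i\<in>F. c i = 0"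
  shows "finite I"
proof (rule ccontr)
  assume "infinite I"
  obtain K where K: "\<And>w p. \<lbrakk>smooth w; torus_fun w;
     torus_integral (gradient_product w w) \<le> \<mu> * torus_integral (\<lambda>p. Q (fst p) * (w p)\<^sup>2);
     \<forall>jk\<in>{..<K\<^sup>2} \<times> {..<K}. segment_integral K jk w = 0\<rbrakk> \<Longrightarrow> w p = 0"
    using low_energy_determined_by_segment_integrals[OF Q, of \<mu>] by blast
  let ?E = "{..<K\<^sup>2} \<times> {..<K}"
  obtain F where F: "finite F" "F \<subseteq> I" "card F = Suc (card ?E)"
    using infinite_arbitrarily_large[OF \<open>infinite I\<close>] by blast
  then obtain c where c: "\<exists>i\<in>F. c i \<noteq> 0"
    "\<forall>jk\<in>?E. (\<Sum>i\<in>F. c i * segment_integral K jk (u i)) = 0"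
    using homogeneous_system_nontrivial_solution[of ?E F "\<lambda>jk i. segment_integral K jk (u i)"] by auto
  define w where "w = (\<lambda>p. \<Sum>i\<in>F. c i * u i p)"
  have "w p = 0" for p
  proof (rule K)
    show "smooth w" "torus_fun w"
      unfolding w_def using F u by (auto intro!: smooth_lincomb torus_fun_lincomb)
    show "torus_integral (gradient_product w w) \<le> \<mu> * torus_integral (\<lambda>p. Q (fst p) * (w p)\<^sup>2)"
      by (rule energy[OF F(1,2) w_def])
    show "\<forall>jk\<in>?E. segment_integral K jk w = 0"
      unfolding w_def using c(2) F u by (subst segment_integral_lincomb) auto
  qed
  then have "\<forall>i\<in>F. c i = 0"
    using indep[OF F(1,2), of c] unfolding w_def by blast
  with c(1) show False by blast
qed

lemma subspace_eigenspace:
  assumes Q: "conformal_factor Q"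
  shows "subspace (eigenspace Q \<nu>)"
proof -
  have iff: "w \<in> eigenspace Q \<nu> \<longleftrightarrow> smooth w \<and> torus_fun w \<and> (\<forall>p. laplacian w p = - \<nu> * Q (fst p) * w p)" for w
  proof
    assume "smooth w \<and> torus_fun w \<and> (\<forall>p. laplacian w p = - \<nu> * Q (fst p) * w p)"
    moreover have "Q x > 0" for x using Q by (simp add: conformal_factor_def)
    ultimately show "w \<in> eigenspace Q \<nu>"
      by (auto simp: eigenspace_def laplace_beltrami_def less_le)
  qed (use eigenspaceD[OF Q] in blast)
  have sum2: "(\<Sum>i\<in>UNIV. f i) = f False + f True" for f :: "bool \<Rightarrow> real"
    by (simp add: UNIV_bool)
  have comb: "(\<lambda>p. a * u p + b * v p) \<in> eigenspace Q \<nu>"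
    if "u \<in> eigenspace Q \<nu>" "v \<in> eigenspace Q \<nu>" for a b u v
  proof -
    let ?c = "\<lambda>i. if i then b else a" and ?u = "\<lambda>i. if i then v else u"
    have *: "(\<lambda>p. a * u p + b * v p) = (\<lambda>p. \<Sum>i\<in>UNIV. ?c i * ?u i p)"
      by (simp add: sum2)
    have sm: "smooth (?u i)" "torus_fun (?u i)" for i
      using that by (auto simp: iff)
    have "laplacian (\<lambda>p. \<Sum>i\<in>UNIV. ?c i * ?u i p) p = - \<nu> * Q (fst p) * (\<Sum>i\<in>UNIV. ?c i * ?u i p)" for p
    proof -
      have "laplacian u p = - \<nu> * Q (fst p) * u p" "laplacian v p = - \<nu> * Q (fst p) * v p"
        using that iff by blast+
      then show ?thesis
        unfolding laplacian_lincomb[of UNIV ?u, OF sm(1)] by (simp add: sum2 algebra_simps)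
    qed
    then show ?thesis
      unfolding iff * by (intro conjI allI smooth_lincomb torus_fun_lincomb sm)
  qed
  have 0: "0 \<in> eigenspace Q \<nu>"
    using laplacian_lincomb[of "{}" "\<lambda>_ _. 0" "\<lambda>_. 0"]
    by (auto simp: iff zero_fun_def torus_fun_def)
  show ?thesis
    unfolding subspace_def
  proof (intro conjI ballI allI)
    show "u + v \<in> eigenspace Q \<nu>" if "u \<in> eigenspace Q \<nu>" "v \<in> eigenspace Q \<nu>" for u v
      using comb[OF that, of 1 1] by (simp add: plus_fun_def)
    show "c *\<^sub>R u \<in> eigenspace Q \<nu>" if "u \<in> eigenspace Q \<nu>" for c u
      using comb[OF that 0, of c 0] by (simp add: scaleR_fun_def)
  qed (rule 0)
qed

lemma eigenspace_energy:
  assumes Q: "conformal_factor Q" and w: "w \<in> eigenspace Q \<nu>"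
  shows "torus_integral (gradient_product w w) = \<nu> * torus_integral (\<lambda>p. Q (fst p) * (w p)\<^sup>2)"
proof -
  note W = eigenspaceD[OF Q w]
  have eq: "(\<lambda>p. w p * laplacian w p) = (\<lambda>p. - \<nu> * (Q (fst p) * (w p)\<^sup>2))"
    by (rule ext) (simp add: W(3) power2_eq_square)
  have "- torus_integral (gradient_product w w) = torus_integral (\<lambda>p. w p * laplacian w p)"
    by (simp only: greens_identity[OF W(1,2) W(1,2)])
  also have "\<dots> = - \<nu> * torus_integral (\<lambda>p. Q (fst p) * (w p)\<^sup>2)"
    unfolding eq by (rule torus_integral_cmult)
  finally show ?thesis by simp
qed

text \<open>As \<^const>\<open>dim\<close> is zero on spaces of infinite dimension, positivity carries the finiteness of
  multiplicities.\<close>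

lemma dim_eigenspace_pos:
  assumes Q: "conformal_factor Q" and ev: "eigenvalue Q \<nu>"
  shows "dim (eigenspace Q \<nu>) > 0"
proof -
  obtain B where B: "B \<subseteq> eigenspace Q \<nu>" "independent B" "eigenspace Q \<nu> \<subseteq> span B"
    "card B = dim (eigenspace Q \<nu>)"
    using basis_exists by blast
  have "finite B"
  proof (rule finite_of_low_energy_combinations[OF Q, of B "\<lambda>b. b" \<nu>])
    show "smooth b" "torus_fun b" if "b \<in> B" for b
      using that B(1) eigenspaceD[OF Q] by blast+
    have eq: "(\<lambda>p. \<Sum>b\<in>F. c b * b p) = (\<Sum>b\<in>F. c b *\<^sub>R b)"
      for F :: "(real \<times> real \<Rightarrow> real) set" and c
      by (induction F rule: infinite_finite_induct)
        (auto simp: zero_fun_def plus_fun_def scaleR_fun_def fun_eq_iff)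
    show "torus_integral (gradient_product w w) \<le> \<nu> * torus_integral (\<lambda>p. Q (fst p) * (w p)\<^sup>2)"
      if "finite F" "F \<subseteq> B" "w = (\<lambda>p. \<Sum>b\<in>F. c b * b p)" for F c w
    proof -
      have "w \<in> eigenspace Q \<nu>"
        unfolding that(3) eq using that B(1)
        by (intro subspace_sum subspace_mul subspace_eigenspace[OF Q]) auto
      then show ?thesis by (simp add: eigenspace_energy[OF Q])
    qed
    show "\<forall>b\<in>F. c b = 0" if "finite F" "F \<subseteq> B" "\<And>p. (\<Sum>b\<in>F. c b * b p) = 0" for F c
    proof -
      have "(\<Sum>b\<in>F. c b *\<^sub>R b) = 0"
        unfolding eq[symmetric] using that(3) by (simp add: zero_fun_def)
      then show ?thesis
        using B(2) that independentD by blast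
    qed
  qed
  moreover have "B \<noteq> {}"
  proof
    assume "B = {}"
    with B(3) have "eigenspace Q \<nu> \<subseteq> {0}" by simp
    with ev show False by (auto simp: eigenvalue_def eigenfunction_def)
  qed
  ultimately show ?thesis using B(4) by (metis card_gt_0_iff)
qed

text \<open>Eigenfunctions for distinct eigenvalues are orthogonal, so the energy of a combination is
  the sum of the energies of its terms, each of which is at most \<open>\<mu>\<close> times the squared weighted norm
  of the term.\<close>

lemma finite_eigenvalues:
  assumes Q: "conformal_factor Q"
  shows "finite {\<nu>. eigenvalue Q \<nu> \<and> \<nu> \<le> \<mu>}" (is "finite ?I")
proof -
  have "\<forall>\<nu>\<in>?I. \<exists>w. w \<in> eigenspace Q \<nu> \<and> w \<noteq> 0"
    by (auto simp: eigenvalue_def eigenfunction_def)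
  then obtain u where u: "\<And>\<nu>. \<nu> \<in> ?I \<Longrightarrow> u \<nu> \<in> eigenspace Q \<nu>" "\<And>\<nu>. \<nu> \<in> ?I \<Longrightarrow> u \<nu> \<noteq> 0"
    by metis
  note U = eigenspaceD[OF Q u(1)]
  let ?w = "\<lambda>F c p. \<Sum>\<nu>\<in>F. c \<nu> * u \<nu> p"
  let ?n = "\<lambda>\<nu>. torus_integral (\<lambda>p. Q (fst p) * (u \<nu> p)\<^sup>2)"
  have cQ: "continuous_on UNIV (\<lambda>p :: real \<times> real. Q (fst p))"
    by (intro smooth_continuous conformal_factor_smooth Q)
  have cu: "continuous_on UNIV (u \<nu>)" if "\<nu> \<in> ?I" for \<nu>
    using U(1)[OF that] by (rule smooth_continuous)
  have n0: "?n \<nu> > 0" if \<nu>: "\<nu> \<in> ?I" for \<nu>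
  proof (rule ccontr)
    assume "\<not> ?n \<nu> > 0"
    moreover have "torus_fun (\<lambda>p. Q (fst p) * (u \<nu> p)\<^sup>2)"
      using Q U(2)[OF \<nu>] by (auto simp: conformal_factor_def circle_fun_def torus_fun_def)
    ultimately have "Q (fst p) * (u \<nu> p)\<^sup>2 = 0" for p
      using Q by (intro torus_integral_zero_imp_zero)
        (auto simp: conformal_factor_def less_imp_le intro!: continuous_intros cQ cu[OF \<nu>])
    then have "u \<nu> p = 0" for p using Q by (auto simp: conformal_factor_def less_le)
    then show False using u(2)[OF \<nu>] by (auto simp: zero_fun_def)
  qed
  have parseval: "torus_integral (\<lambda>p. Q (fst p) * (?w F c p * ?w F d p)) = (\<Sum>\<nu>\<in>F. c \<nu> * d \<nu> * ?n \<nu>)"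
    if F: "finite F" "F \<subseteq> ?I" for F c d
  proof -
    have I: "\<nu> \<in> F \<Longrightarrow> \<nu> \<in> ?I" for \<nu> using F by blast
    have c2: "continuous_on UNIV (\<lambda>p. c \<nu> * d \<nu>' * (Q (fst p) * (u \<nu> p * u \<nu>' p)))"
      if "\<nu> \<in> F" "\<nu>' \<in> F" for \<nu> \<nu>'
      by (intro continuous_intros cQ cu I that)
    have "torus_integral (\<lambda>p. Q (fst p) * (?w F c p * ?w F d p))
        = torus_integral (\<lambda>p. \<Sum>\<nu>\<in>F. \<Sum>\<nu>'\<in>F. c \<nu> * d \<nu>' * (Q (fst p) * (u \<nu> p * u \<nu>' p)))"
      unfolding sum_product unfolding sum_distrib_left
      by (rule arg_cong[where f = torus_integral], rule ext, intro sum.cong refl) (simp add: mult_ac)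
    also have "\<dots> = (\<Sum>\<nu>\<in>F. \<Sum>\<nu>'\<in>F. torus_integral (\<lambda>p. c \<nu> * d \<nu>' * (Q (fst p) * (u \<nu> p * u \<nu>' p))))"
      by (subst torus_integral_sum[OF F(1)], intro continuous_on_sum c2, assumption+)
        (auto intro!: sum.cong torus_integral_sum F(1) c2)
    also have "\<dots> = (\<Sum>\<nu>\<in>F. \<Sum>\<nu>'\<in>F. if \<nu>' = \<nu> then c \<nu> * d \<nu> * ?n \<nu> else 0)"
      unfolding torus_integral_cmult
      by (intro sum.cong refl) (auto simp: orthogonality[OF Q u(1)[OF I] u(1)[OF I]] power2_eq_square)
    also have "\<dots> = (\<Sum>\<nu>\<in>F. c \<nu> * d \<nu> * ?n \<nu>)"
      using F by simp
    finally show ?thesis .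
  qed
  show ?thesis
  proof (rule finite_of_low_energy_combinations[OF Q, of ?I u \<mu>])
    show "smooth (u \<nu>)" "torus_fun (u \<nu>)" if "\<nu> \<in> ?I" for \<nu> by (rule U[OF that])+
    show "torus_integral (gradient_product w w) \<le> \<mu> * torus_integral (\<lambda>p. Q (fst p) * (w p)\<^sup>2)"
      if F: "finite F" "F \<subseteq> ?I" and w: "w = ?w F c" for F c w
    proof -
      have I: "\<nu> \<in> F \<Longrightarrow> \<nu> \<in> ?I" for \<nu> using F by blast
      have sm: "smooth (?w F c)" "torus_fun (?w F c)"
        by (intro smooth_lincomb torus_fun_lincomb U I; assumption)+
      have lap: "laplacian (?w F c) p = - (Q (fst p) * ?w F (\<lambda>\<nu>. c \<nu> * \<nu>) p)" for p
      proof -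
        have "c \<nu> * laplacian (u \<nu>) p = - (Q (fst p) * (c \<nu> * \<nu> * u \<nu> p))" if "\<nu> \<in> F" for \<nu>
          unfolding U(3)[OF I[OF that]] by simp
        moreover have "laplacian (?w F c) p = (\<Sum>\<nu>\<in>F. c \<nu> * laplacian (u \<nu>) p)"
          by (rule laplacian_lincomb) (rule U(1)[OF I])
        ultimately show ?thesis
          by (simp add: sum_distrib_left sum_negf)
      qed
      have "torus_integral (gradient_product w w) = - torus_integral (\<lambda>p. ?w F c p * laplacian (?w F c) p)"
        unfolding w by (simp only: greens_identity[OF sm sm] minus_minus)
      also have "\<dots> = torus_integral (\<lambda>p. Q (fst p) * (?w F c p * ?w F (\<lambda>\<nu>. c \<nu> * \<nu>) p))"
        unfolding torus_integral_minus[symmetric] by (simp add: lap mult_ac)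
      also have "\<dots> = (\<Sum>\<nu>\<in>F. c \<nu> * (c \<nu> * \<nu>) * ?n \<nu>)"
        by (rule parseval[OF F])
      also have "\<dots> \<le> (\<Sum>\<nu>\<in>F. \<mu> * (c \<nu> * c \<nu> * ?n \<nu>))"
      proof (rule sum_mono)
        fix \<nu> assume "\<nu> \<in> F"
        from I[OF this] n0[OF I[OF this]]
        have "\<nu> * (c \<nu> * c \<nu> * ?n \<nu>) \<le> \<mu> * (c \<nu> * c \<nu> * ?n \<nu>)"
          by (intro mult_right_mono) auto
        then show "c \<nu> * (c \<nu> * \<nu>) * ?n \<nu> \<le> \<mu> * (c \<nu> * c \<nu> * ?n \<nu>)" by (simp add: mult_ac)
      qed
      also have "\<dots> = \<mu> * torus_integral (\<lambda>p. Q (fst p) * (w p)\<^sup>2)"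
        unfolding w power2_eq_square using parseval[OF F, of c c]
        by (simp add: sum_distrib_left power2_eq_square)
      finally show ?thesis .
    qed
    show "\<forall>\<nu>\<in>F. c \<nu> = 0" if F: "finite F" "F \<subseteq> ?I" and z: "\<And>p. ?w F c p = 0" for F c
    proof -
      have "(\<Sum>\<nu>\<in>F. c \<nu> * c \<nu> * ?n \<nu>) = torus_integral (\<lambda>p. 0)"
        unfolding parseval[OF F, of c c, symmetric] z by simp
      also have "\<dots> = 0" by (simp add: torus_integral_def)
      finally have "\<forall>\<nu>\<in>F. c \<nu> * c \<nu> * ?n \<nu> = 0"
        using F n0 by (subst sum_nonneg_eq_0_iff[symmetric]) (auto simp: less_imp_le)
      then show ?thesis using F n0 by (fastforce simp: less_le)
    qed
  qed
qed

text \<open>The counting function jumps at each eigenvalue \<open>\<nu>\<close> by its multiplicity, so \<open>\<nu>\<close> is the least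
  number at which the value \<open>eigenvalue_count Q \<nu>\<close> is reached.\<close>

lemma nth_eigenvalue_attained:
  assumes Q: "conformal_factor Q" and ev: "eigenvalue Q \<nu>"
  shows "eigenvalue_count Q \<nu> \<ge> 1" "nth_eigenvalue Q (eigenvalue_count Q \<nu>) = \<nu>"
proof -
  let ?I = "\<lambda>\<mu>. {\<nu>. eigenvalue Q \<nu> \<and> \<nu> \<le> \<mu>}"
  have split: "eigenvalue_count Q \<nu> = dim (eigenspace Q \<nu>) + (\<Sum>\<mu>\<in>?I \<nu> - {\<nu>}. dim (eigenspace Q \<mu>))"
    unfolding eigenvalue_count_def using ev finite_eigenvalues[OF Q] by (subst sum.remove[of _ \<nu>]) auto
  then show "eigenvalue_count Q \<nu> \<ge> 1"
    using dim_eigenspace_pos[OF Q ev] by simp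
  have "\<nu> \<le> \<mu>" if "eigenvalue_count Q \<nu> \<le> eigenvalue_count Q \<mu>" for \<mu>
  proof (rule ccontr)
    assume "\<not> \<nu> \<le> \<mu>"
    then have "eigenvalue_count Q \<mu> \<le> (\<Sum>\<mu>\<in>?I \<nu> - {\<nu>}. dim (eigenspace Q \<mu>))"
      unfolding eigenvalue_count_def using finite_eigenvalues[OF Q, of \<nu>] by (intro sum_mono2) auto
    with split dim_eigenspace_pos[OF Q ev] that show False by simp
  qed
  then show "nth_eigenvalue Q (eigenvalue_count Q \<nu>) = \<nu>"
    unfolding nth_eigenvalue_def by (intro Least_equality) auto
qed

lemma eigenfunction_in_L_space:
  assumes "conformal_factor Q" "eigenfunction Q \<nu> w" "eigenvalue_count Q \<nu> \<le> n"
  shows "w \<in> L_space Q n"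
proof -
  have "eigenvalue Q \<nu>" using assms by (auto simp: eigenvalue_def)
  from nth_eigenvalue_attained[OF assms(1) this] assms(2,3) show ?thesis
    unfolding L_space_def by (intro span_base UN_I[of "eigenvalue_count Q \<nu>"]) auto
qed


section \<open>Flat oscillating functions\<close>

text \<open>The functions \<open>exp (- 1 / t\<^sup>2) * (p (1 / t) * sin (1 / t) + q (1 / t) * cos (1 / t))\<close> with
  polynomials \<open>p\<close> and \<open>q\<close>, extended by zero, form a class that is stable under differentiation. The
  class contains a smooth function that changes sign infinitely often near the origin.\<close>

definition flat_osc :: "real poly \<Rightarrow> real poly \<Rightarrow> real \<Rightarrow> real"
  where "flat_osc p q t = (if t = 0 then 0 else
    exp (- (1 / t)\<^sup>2) * (poly p (1 / t) * sin (1 / t) + poly q (1 / t) * cos (1 / t)))"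

text \<open>The exponential series dominates its term of degree \<open>n + 1\<close>. A bound of second order in \<open>t\<close> is
  what makes the derivative at the origin vanish.\<close>

lemma power_times_exp_bound:
  fixes t :: real
  assumes "t \<noteq> 0" "\<bar>t\<bar> \<le> 1"
  shows "\<bar>1 / t\<bar> ^ n * exp (- (1 / t)\<^sup>2) \<le> fact (Suc n) * t\<^sup>2"
proof -
  define s where "s = \<bar>1 / t\<bar>"
  have s: "s \<ge> 1" "(1 / t)\<^sup>2 = s\<^sup>2" "t\<^sup>2 = 1 / s\<^sup>2"
    using assms by (auto simp: s_def power_divide)
  have "(s\<^sup>2) ^ Suc n / fact (Suc n) \<le> (\<Sum>k. (s\<^sup>2) ^ k / fact k)"
    using sum_le_suminf[OF summable_exp_generic[of "s\<^sup>2"], of "{Suc n}"] s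
    by (simp add: divide_inverse mult.commute)
  also have "\<dots> = exp (s\<^sup>2)"
    by (simp add: exp_def divide_inverse mult.commute)
  finally have *: "(s\<^sup>2) ^ Suc n \<le> fact (Suc n) * exp (s\<^sup>2)"
    by (simp add: divide_le_eq mult.commute)
  have "s ^ n * s\<^sup>2 \<le> s ^ (n + n) * s\<^sup>2"
    using s by (intro mult_right_mono power_increasing) auto
  also have "\<dots> = (s\<^sup>2) ^ Suc n"
    by (simp add: power_mult[symmetric] power_add[symmetric] mult_2)
  also note *
  finally have "s ^ n * s\<^sup>2 \<le> fact (Suc n) * exp (s\<^sup>2)" .
  moreover have "s > 0" using s by simp
  ultimately show ?thesis
    unfolding s s_def[symmetric] by (simp add: exp_minus divide_simps mult_ac del: fact_Suc)
qed

text \<open>The additional power of \<open>1 / t\<close> is there for the induction, in which it absorbs the factor that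
  the constructor \<open>pCons\<close> contributes.\<close>

lemma poly_times_exp_bound:
  "\<exists>C. \<forall>t::real. t \<noteq> 0 \<longrightarrow> \<bar>t\<bar> \<le> 1 \<longrightarrow>
     \<bar>1 / t\<bar> ^ n * \<bar>poly p (1 / t)\<bar> * exp (- (1 / t)\<^sup>2) \<le> C * t\<^sup>2"
proof (induction p arbitrary: n)
  case 0
  show ?case by (rule exI[of _ 0]) simp
next
  case (pCons a p)
  from pCons.IH[of "Suc n"] obtain C where
    C: "\<And>t. t \<noteq> 0 \<Longrightarrow> \<bar>t\<bar> \<le> 1 \<Longrightarrow>
      \<bar>1 / t\<bar> ^ Suc n * \<bar>poly p (1 / t)\<bar> * exp (- (1 / t)\<^sup>2) \<le> C * t\<^sup>2" by blast
  have "\<bar>1 / t\<bar> ^ n * \<bar>poly (pCons a p) (1 / t)\<bar> * exp (- (1 / t)\<^sup>2)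
      \<le> (\<bar>a\<bar> * fact (Suc n) + C) * t\<^sup>2" if t: "t \<noteq> 0" "\<bar>t\<bar> \<le> 1" for t :: real
  proof -
    have "\<bar>1 / t\<bar> ^ n * \<bar>poly (pCons a p) (1 / t)\<bar> * exp (- (1 / t)\<^sup>2)
      \<le> \<bar>1 / t\<bar> ^ n * (\<bar>a\<bar> + \<bar>1 / t\<bar> * \<bar>poly p (1 / t)\<bar>) * exp (- (1 / t)\<^sup>2)"
      using abs_triangle_ineq[of a "(1 / t) * poly p (1 / t)"]
      by (intro mult_right_mono mult_left_mono) (auto simp: abs_mult)
    also have "\<dots> = \<bar>a\<bar> * (\<bar>1 / t\<bar> ^ n * exp (- (1 / t)\<^sup>2))
        + \<bar>1 / t\<bar> ^ Suc n * \<bar>poly p (1 / t)\<bar> * exp (- (1 / t)\<^sup>2)"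
      by (simp add: algebra_simps)
    also have "\<dots> \<le> \<bar>a\<bar> * (fact (Suc n) * t\<^sup>2) + C * t\<^sup>2"
      using power_times_exp_bound[OF t] C[OF t] by (intro add_mono mult_left_mono) auto
    finally show ?thesis by (simp add: algebra_simps)
  qed
  then show ?case by blast
qed

text \<open>Away from the origin this is the chain rule: in the variable \<open>s = 1 / t\<close> differentiation by \<open>t\<close>
  becomes \<open>- s\<^sup>2\<close> times differentiation by \<open>s\<close>. At the origin it is the quadratic bound.\<close>

lemma flat_osc_has_derivative:
  "(flat_osc p q has_field_derivative
     flat_osc (- (monom 1 2 * (pderiv p - monom 2 1 * p - q)))
       (- (monom 1 2 * (pderiv q - monom 2 1 * q + p))) t) (at t)"
proof (cases "t = 0")
  case False
  let ?g = "\<lambda>t. exp (- (1 / t)\<^sup>2) * (poly p (1 / t) * sin (1 / t) + poly q (1 / t) * cos (1 / t))"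
  have "(?g has_field_derivative flat_osc (- (monom 1 2 * (pderiv p - monom 2 1 * p - q)))
       (- (monom 1 2 * (pderiv q - monom 2 1 * q + p))) t) (at t)"
    using False
    by (auto intro!: derivative_eq_intros DERIV_chain2[OF poly_DERIV]
        simp: flat_osc_def poly_monom divide_simps power2_eq_square)
      (simp add: algebra_simps)
  then show ?thesis
    by (rule has_field_derivative_transform_within_open[of _ _ _ "- {0}"])
      (use False in \<open>auto simp: flat_osc_def\<close>)
next
  case True
  obtain C D where
    C: "\<And>t. t \<noteq> 0 \<Longrightarrow> \<bar>t\<bar> \<le> 1 \<Longrightarrow> \<bar>poly p (1 / t)\<bar> * exp (- (1 / t)\<^sup>2) \<le> C * t\<^sup>2" and
    D: "\<And>t. t \<noteq> 0 \<Longrightarrow> \<bar>t\<bar> \<le> 1 \<Longrightarrow> \<bar>poly q (1 / t)\<bar> * exp (- (1 / t)\<^sup>2) \<le> D * t\<^sup>2"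
    using poly_times_exp_bound[of 0 p] poly_times_exp_bound[of 0 q] by auto
  have bound: "\<bar>flat_osc p q t / t\<bar> \<le> (C + D) * \<bar>t\<bar>" if t: "t \<noteq> 0" "\<bar>t\<bar> \<le> 1" for t
  proof -
    have "\<bar>flat_osc p q t\<bar> = exp (- (1 / t)\<^sup>2) *
        \<bar>poly p (1 / t) * sin (1 / t) + poly q (1 / t) * cos (1 / t)\<bar>"
      using t by (simp add: flat_osc_def abs_mult)
    also have "\<dots> \<le> exp (- (1 / t)\<^sup>2) * (\<bar>poly p (1 / t)\<bar> * 1 + \<bar>poly q (1 / t)\<bar> * 1)"
      by (intro mult_left_mono order_trans[OF abs_triangle_ineq] add_mono)
        (auto simp: abs_mult mult_left_le)
    also have "\<dots> \<le> C * t\<^sup>2 + D * t\<^sup>2"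
      using C[OF t] D[OF t] by (simp add: algebra_simps)
    also have "\<dots> = (C + D) * \<bar>t\<bar> * \<bar>t\<bar>"
      by (simp add: algebra_simps power2_eq_square)
    finally show ?thesis
      using t by (simp add: abs_divide divide_le_eq)
  qed
  have "((\<lambda>t. flat_osc p q t / t) \<longlongrightarrow> 0) (at 0)"
  proof (rule Lim_null_comparison)
    show "\<forall>\<^sub>F t in at 0. norm (flat_osc p q t / t) \<le> (C + D) * \<bar>t\<bar>"
      using bound by (auto simp: eventually_at intro!: exI[of _ 1])
    show "((\<lambda>t. (C + D) * \<bar>t\<bar>) \<longlongrightarrow> 0) (at 0)"
      by (auto intro!: tendsto_eq_intros)
  qed
  then show ?thesis
    using True by (simp add: has_field_derivative_iff flat_osc_def)
qed

lemma smooth_flat_osc: "smooth (flat_osc p q)"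
proof (rule smooth_of_derivatives)
  show "flat_osc p q \<in> range (\<lambda>(p, q). flat_osc p q)" by auto
  show "\<exists>g\<in>range (\<lambda>(p, q). flat_osc p q). \<forall>x. (f has_field_derivative g x) (at x)"
    if "f \<in> range (\<lambda>(p, q). flat_osc p q)" for f
    using that flat_osc_has_derivative by fast
qed


section \<open>The eigenfunction and its super-level set\<close>

lemma circle_fun_continuous_bounded:
  fixes f :: "real \<Rightarrow> real"
  assumes "circle_fun f" "continuous_on UNIV f"
  shows "\<exists>M\<ge>0. \<forall>x. \<bar>f x\<bar> \<le> M"
proof -
  have "\<exists>x\<in>{0..2*pi}. \<forall>y\<in>{0..2*pi}. \<bar>f y\<bar> \<le> \<bar>f x\<bar>"
    by (rule continuous_attains_sup) (auto intro!: continuous_intros continuous_on_subset[OF assms(2)])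
  then obtain a where a: "\<And>y. y \<in> {0..2*pi} \<Longrightarrow> \<bar>f y\<bar> \<le> \<bar>f a\<bar>" by blast
  have "\<bar>f x\<bar> \<le> \<bar>f a\<bar>" for x
    using period_representative[of x] circle_fun_shift[OF assms(1)] a by metis
  then show ?thesis by (intro exI[of _ "\<bar>f a\<bar>"]) auto
qed

lemma circle_fun_deriv:
  fixes f f' :: "real \<Rightarrow> real"
  assumes "circle_fun f" "\<And>x. (f has_field_derivative f' x) (at x)"
  shows "circle_fun f'"
proof -
  have "f' (x + 2 * pi) = f' x" for x
  proof -
    have "((\<lambda>x. f (x + 2 * pi)) has_field_derivative f' (x + 2 * pi)) (at x)"
      using assms(2)[of "x + 2 * pi"] by (simp add: DERIV_shift)
    moreover have "(\<lambda>x. f (x + 2 * pi)) = f"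
      using assms(1) by (auto simp: circle_fun_def)
    ultimately show ?thesis using assms(2)[of x] DERIV_unique by metis
  qed
  then show ?thesis by (simp add: circle_fun_def)
qed

abbreviation osc :: "real \<Rightarrow> real"
  where "osc \<equiv> flat_osc 1 0"

lemma osc_le_1: "\<bar>osc t\<bar> \<le> 1"
  by (simp add: flat_osc_def abs_mult mult_le_one)

text \<open>Points at which the sine of the reciprocal equals \<open>1\<close>.\<close>

definition bump_height :: "nat \<Rightarrow> real"
  where "bump_height n = 1 / (pi / 2 + 2 * pi * real n)"

lemma bump_height: "0 < bump_height n" "bump_height n < 1" "osc (bump_height n) > 0"
proof -
  have *: "pi / 2 + 2 * pi * real n > 1"
  proof -
    have "2 * pi * real n \<ge> 0" by simp
    then show ?thesis using pi_gt3 by linarith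
  qed
  then show "0 < bump_height n" "bump_height n < 1" by (simp_all add: bump_height_def)
  have "sin (pi / 2 + 2 * pi * real n) = 1"
    using cos_2npi[of n] sin_2npi[of n] by (simp add: sin_add mult_ac)
  with * show "osc (bump_height n) > 0"
    by (simp add: flat_osc_def bump_height_def)
qed

lemma osc_negative_between:
  assumes "m < n"
  shows "\<exists>t. bump_height n < t \<and> t < bump_height m \<and> osc t < 0"
proof (intro exI conjI)
  let ?s = "3 * pi / 2 + 2 * pi * real m"
  have pos: "?s > 0" "pi / 2 + 2 * pi * real m > 0" by (auto intro!: add_pos_nonneg)
  have "real m + 1 \<le> real n" using assms by simp
  then have "2 * pi * (real m + 1) \<le> 2 * pi * real n" by (intro mult_left_mono) auto
  then have "?s < pi / 2 + 2 * pi * real n"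
    using pi_gt_zero by (simp only: distrib_left mult_1_right)
  with pos show "bump_height n < 1 / ?s"
    unfolding bump_height_def by (intro divide_strict_left_mono) auto
  show "1 / ?s < bump_height m"
    unfolding bump_height_def using pos by (intro divide_strict_left_mono mult_pos_pos) auto
  have "sin (3 * pi / 2 + 2 * pi * real m) = sin (3 * pi / 2)"
    using cos_2npi[of m] sin_2npi[of m] by (simp add: sin_add mult_ac)
  also have "\<dots> = -1"
    using sin_3over2_pi by simp
  finally show "osc (1 / ?s) < 0"
    using pos by (simp add: flat_osc_def)
qed

definition profile :: "real \<Rightarrow> real \<Rightarrow> real"
  where "profile \<epsilon> t = 1 + \<epsilon> * osc t"

text \<open>The eigenfunction on the torus as a subset of \<open>\<complex>\<^sup>2\<close>, where \<open>sin x\<close> is the imaginary part of the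
  first coordinate and \<open>cos y\<close> the real part of the second. The formula extends to all of \<open>\<complex>\<^sup>2\<close>, so its
  continuity does not involve the quotient map.\<close>

definition Phi_torus :: "real \<Rightarrow> complex \<times> complex \<Rightarrow> real"
  where "Phi_torus \<epsilon> z = profile \<epsilon> (Im (fst z)) * Re (snd z)"

definition Phi :: "real \<Rightarrow> real \<times> real \<Rightarrow> real"
  where "Phi \<epsilon> p = profile \<epsilon> (sin (fst p)) * cos (snd p)"

lemma Phi_factors: "Phi_torus \<epsilon> (torus_proj p) = Phi \<epsilon> p"
  by (cases p) (simp add: Phi_def Phi_torus_def torus_proj_def)

lemma smooth_profile: "smooth (profile \<epsilon>)"
  unfolding profile_def[abs_def] by (intro smooth_add smooth_mult smooth_const smooth_flat_osc)

lemma continuous_Phi_torus: "continuous_on S (Phi_torus \<epsilon>)"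
  unfolding Phi_torus_def
  by (intro continuous_intros continuous_on_compose2[OF smooth_continuous[OF smooth_profile, of UNIV]]) auto

lemma infinite_components_of_separated_sequence:
  fixes p :: "nat \<Rightarrow> 'a::topological_space"
  assumes p: "\<And>n. p n \<in> U"
    and sep: "\<And>m n C. m < n \<Longrightarrow> connected C \<Longrightarrow> C \<subseteq> U \<Longrightarrow> p m \<in> C \<Longrightarrow> p n \<in> C \<Longrightarrow> False"
  shows "infinite (components U)"
proof
  assume "finite (components U)"
  moreover have "range (\<lambda>n. connected_component_set U (p n)) \<subseteq> components U"
    using p by (auto simp: components_def)
  ultimately have "finite (range (\<lambda>n. connected_component_set U (p n)))"
    using finite_subset by blast
  then obtain m n where mn: "m \<noteq> n" "connected_component_set U (p m) = connected_component_set U (p n)"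
    by (metis (mono_tags, lifting) finite_imageD infinite_UNIV_nat inj_onI)
  let ?C = "connected_component_set U (p m)"
  have "connected ?C" "?C \<subseteq> U" "p m \<in> ?C" "p n \<in> ?C"
    using p mn(2) by (auto simp: connected_component_subset)
  then show False
    using sep[of m n ?C] sep[of n m ?C] mn(1) by linarith
qed

text \<open>Heights are compared through \<open>sin x\<close>. On the way from one bump to another, a connected set
  passes a height at which the profile is below \<open>1\<close>, and there \<open>\<Phi>\<close> does not exceed \<open>1\<close>
  because the profile is positive and \<open>cos y \<le> 1\<close>.\<close>

lemma superlevel_separation:
  assumes \<epsilon>: "0 < \<epsilon>" "\<epsilon> < 1" and mn: "m < n"
    and C: "connected C" "C \<subseteq> torus" "\<And>z. z \<in> C \<Longrightarrow> Phi_torus \<epsilon> z > 1"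
    and "z \<in> C" "Im (fst z) = bump_height m" "z' \<in> C" "Im (fst z') = bump_height n"
  shows False
proof -
  obtain t where t: "bump_height n < t" "t < bump_height m" "osc t < 0"
    using osc_negative_between[OF mn] by blast
  have "connected ((\<lambda>z. Im (fst z)) ` C)"
    by (intro connected_continuous_image C continuous_intros)
  moreover have "bump_height n \<in> (\<lambda>z. Im (fst z)) ` C" "bump_height m \<in> (\<lambda>z. Im (fst z)) ` C"
    using assms(7-) by (metis image_eqI)+
  ultimately have "t \<in> (\<lambda>z. Im (fst z)) ` C"
    by (rule connectedD_interval) (use t in \<open>simp_all\<close>)
  then obtain \<zeta> where \<zeta>: "\<zeta> \<in> C" "Im (fst \<zeta>) = t" by blast
  have "norm (snd \<zeta>) = 1" using \<zeta>(1) C(2) by (auto simp: torus_def)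
  then have "Re (snd \<zeta>) \<le> 1" using complex_Re_le_cmod[of "snd \<zeta>"] by simp
  moreover have "profile \<epsilon> t > 0" "profile \<epsilon> t \<le> 1"
  proof -
    have "\<bar>\<epsilon> * osc t\<bar> \<le> \<epsilon> * 1"
      unfolding abs_mult using \<epsilon> osc_le_1 by (intro mult_mono) auto
    then show "profile \<epsilon> t > 0" using \<epsilon> by (simp add: profile_def)
    show "profile \<epsilon> t \<le> 1" using \<epsilon> t by (simp add: profile_def mult_le_0_iff)
  qed
  ultimately have "profile \<epsilon> t * Re (snd \<zeta>) \<le> 1"
    using mult_left_le[of "Re (snd \<zeta>)" "profile \<epsilon> t"] by linarith
  then show False
    using C(3)[OF \<zeta>(1)] \<zeta>(2) by (simp add: Phi_torus_def)
qed

text \<open>Covers at once the super-level set and the complement of the level set: a connected subset of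
  the latter on which \<open>\<Phi>\<close> takes a value above \<open>1\<close> lies entirely above the level.\<close>

lemma infinite_components_of_nodal_sets:
  assumes \<epsilon>: "0 < \<epsilon>" "\<epsilon> < 1" and U: "{p. Phi \<epsilon> p > 1} \<subseteq> U" "U \<subseteq> {p. Phi \<epsilon> p \<noteq> 1}"
  shows "infinite (components (torus_proj ` U))"
proof -
  define p where "p n = torus_proj (arcsin (bump_height n), 0)" for n
  have Im: "Im (fst (p n)) = bump_height n" for n
    using bump_height(1,2)[of n] by (simp add: p_def torus_proj_def)
  have gt: "Phi_torus \<epsilon> (p n) > 1" for n
    using bump_height(3)[of n] \<epsilon> Im[of n] by (simp add: Phi_torus_def profile_def) (simp add: p_def torus_proj_def)
  show ?thesis
  proof (rule infinite_components_of_separated_sequence[where p = p])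
    show "p n \<in> torus_proj ` U" for n
      using gt[of n] U(1) unfolding p_def Phi_factors by auto
    fix m n :: nat and C
    assume mn: "m < n" and C: "connected C" "C \<subseteq> torus_proj ` U" and pC: "p m \<in> C" "p n \<in> C"
    have conn: "connected (Phi_torus \<epsilon> ` C)"
      by (intro connected_continuous_image continuous_Phi_torus C)
    have ne: "Phi_torus \<epsilon> z \<noteq> 1" if z: "z \<in> C" for z
    proof -
      obtain q where "q \<in> U" "z = torus_proj q" using C(2) z by blast
      then show ?thesis using U(2) Phi_factors[of \<epsilon> q] by auto
    qed
    have gt1: "Phi_torus \<epsilon> z > 1" if z: "z \<in> C" for z
    proof (rule ccontr)
      assume "\<not> Phi_torus \<epsilon> z > 1"
      then have "1 \<in> Phi_torus \<epsilon> ` C"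
        using connectedD_interval[OF conn imageI[OF z] imageI[OF pC(1)], of 1] gt[of m] by simp
      then show False using ne by (metis imageE)
    qed
    have "torus_proj q \<in> torus" for q
      by (cases q) (simp add: torus_proj_def torus_def)
    then have "C \<subseteq> torus" using C(2) by blast
    then show False
      by (rule superlevel_separation[OF \<epsilon> mn C(1) _ gt1 pC(1) Im pC(2) Im])
  qed
qed

lemma smooth_circle_profile: "smooth (\<lambda>x. profile \<epsilon> (sin x))"
  by (rule smooth_compose[OF smooth_profile smooth_sin_cos(1)])

lemma smooth_Phi: "smooth (Phi \<epsilon>)"
proof -
  have "smooth (\<lambda>p::real \<times> real. profile \<epsilon> (sin (fst p)))"
    by (rule smooth_compose[OF smooth_circle_profile]) (simp add: smooth_bounded_linear bounded_linear_fst)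
  moreover have "smooth (\<lambda>p::real \<times> real. cos (snd p))"
    by (rule smooth_compose[OF smooth_sin_cos(2)]) (simp add: smooth_bounded_linear bounded_linear_snd)
  ultimately show ?thesis unfolding Phi_def[abs_def] by (rule smooth_mult)
qed

text \<open>With \<open>F x = profile \<epsilon> (sin x)\<close>, the function \<open>\<Phi> (x, y) = F x * cos y\<close> satisfies
  \<open>\<Delta>\<^sub>0 \<Phi> = (F'' x - F x) * cos y\<close>, so it is an eigenfunction with eigenvalue \<open>1\<close> exactly for
  \<open>Q = 1 - F'' / F\<close>. Positivity of \<open>Q\<close> is achieved by making the oscillation small.\<close>

lemma Phi_eigenfunction:
  "\<exists>\<epsilon> Q. 0 < \<epsilon> \<and> \<epsilon> < 1 \<and> smooth Q \<and> circle_fun Q \<and> (\<forall>x. Q x > 0) \<and> Phi \<epsilon> \<in> eigenspace Q 1"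
proof -
  define h where "h x = osc (sin x)" for x
  have sh: "smooth h"
    unfolding h_def[abs_def] by (rule smooth_compose[OF smooth_flat_osc smooth_sin_cos(1)])
  define h2 where "h2 = dir_deriv 1 (dir_deriv 1 h)"
  have D1: "(h has_field_derivative dir_deriv 1 h x) (at x)" for x
    by (rule smooth_has_real_derivative[OF sh])
  have D2: "(dir_deriv 1 h has_field_derivative h2 x) (at x)" for x
    unfolding h2_def by (rule smooth_has_real_derivative[OF smooth_dir_deriv[OF sh]])
  have sh2: "smooth h2" unfolding h2_def by (intro smooth_dir_deriv sh)
  have ch: "circle_fun h" by (simp add: circle_fun_def h_def)
  have ch2: "circle_fun h2"
    by (rule circle_fun_deriv[OF circle_fun_deriv[OF ch D1] D2])
  obtain M where M: "M \<ge> 0" "\<And>x. \<bar>h2 x\<bar> \<le> M"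
    using circle_fun_continuous_bounded[OF ch2 smooth_continuous[OF sh2]] by blast
  \<comment> \<open>Then both \<open>F - 1\<close> and \<open>F''\<close> are at most \<open>1 / 3\<close> in absolute value.\<close>
  define \<epsilon> where "\<epsilon> = 1 / (3 * (M + 1))"
  have \<epsilon>: "0 < \<epsilon>" "\<epsilon> < 1" using M by (auto simp: \<epsilon>_def field_simps)
  have e1: "\<bar>\<epsilon> * h x\<bar> \<le> 1/3" for x
  proof -
    have "\<bar>\<epsilon> * h x\<bar> \<le> \<epsilon> * 1"
      unfolding abs_mult using \<epsilon> osc_le_1 by (intro mult_mono) (auto simp: h_def)
    also have "\<dots> \<le> 1/3" using M by (simp add: \<epsilon>_def field_simps)
    finally show ?thesis .
  qed
  have e2: "\<bar>\<epsilon> * h2 x\<bar> \<le> 1/3" for x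
  proof -
    have "\<bar>\<epsilon> * h2 x\<bar> \<le> \<epsilon> * M"
      unfolding abs_mult using \<epsilon> M by (intro mult_mono) auto
    also have "\<dots> \<le> 1/3" using M by (simp add: \<epsilon>_def field_simps)
    finally show ?thesis .
  qed
  define F where "F x = 1 + \<epsilon> * h x" for x
  have Fp: "F x > 0" and FF: "F x - \<epsilon> * h2 x > 0" for x
    using e1[of x] e2[of x] unfolding F_def by linarith+
  have PhiF: "Phi \<epsilon> (x, y) = F x * cos y" for x y
    by (simp add: Phi_def F_def h_def profile_def)
  have sF: "smooth F" unfolding F_def[abs_def] by (intro smooth_add smooth_mult smooth_const sh)
  define Q where "Q x = 1 + (- \<epsilon>) * (h2 x * inverse (F x))" for x
  have Qeq: "Q x = (F x - \<epsilon> * h2 x) / F x" for x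
    using Fp[of x] by (simp add: Q_def field_simps)
  have Q0: "Q x > 0" for x unfolding Qeq using Fp FF by simp
  have sQ: "smooth Q"
    unfolding Q_def[abs_def] using Fp
    by (intro smooth_add smooth_mult smooth_inverse smooth_const sh2 sF) (simp add: less_imp_neq[symmetric])
  have cQ: "circle_fun Q"
    using ch ch2 by (simp add: circle_fun_def Q_def F_def)
  have "Phi \<epsilon> \<in> eigenspace Q 1"
    unfolding eigenspace_def
  proof (intro CollectI conjI allI)
    show "smooth (Phi \<epsilon>)" by (rule smooth_Phi)
    show "torus_fun (Phi \<epsilon>)" by (simp add: torus_fun_def Phi_def)
    fix p :: "real \<times> real"
    obtain x y where p: "p = (x, y)" by force
    have d1: "deriv (\<lambda>s. F s * cos y) = (\<lambda>s. \<epsilon> * dir_deriv 1 h s * cos y)"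
      by (rule ext, rule DERIV_imp_deriv) (auto simp: F_def intro!: derivative_eq_intros D1)
    have d2: "deriv (\<lambda>s. \<epsilon> * dir_deriv 1 h s * cos y) x = \<epsilon> * h2 x * cos y"
      by (rule DERIV_imp_deriv) (auto intro!: derivative_eq_intros D2)
    have d3: "deriv (\<lambda>t. F x * cos t) = (\<lambda>t. - (F x * sin t))"
      by (rule ext, rule DERIV_imp_deriv) (auto intro!: derivative_eq_intros)
    have d4: "deriv (\<lambda>t. - (F x * sin t)) y = - (F x * cos y)"
      by (rule DERIV_imp_deriv) (auto intro!: derivative_eq_intros)
    have "(deriv ^^ 2) (\<lambda>s. F s * cos y) x = \<epsilon> * h2 x * cos y"
      "(deriv ^^ 2) (\<lambda>t. F x * cos t) y = - (F x * cos y)"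
      by (simp_all only: numeral_2_eq_2 funpow.simps comp_apply id_apply d1 d2 d3 d4)
    then have "laplacian (Phi \<epsilon>) (x, y) = - ((F x - \<epsilon> * h2 x) * cos y)"
      by (simp add: laplacian_def PhiF algebra_simps)
    then have "- laplace_beltrami Q (Phi \<epsilon>) (x, y) = inverse (Q x) * ((F x - \<epsilon> * h2 x) * cos y)"
      by (simp add: laplace_beltrami_def)
    also have "\<dots> = F x * cos y"
      unfolding Qeq using Fp[of x] FF[of x] by (simp add: field_simps)
    finally show "- laplace_beltrami Q (Phi \<epsilon>) p = 1 * Phi \<epsilon> p"
      by (simp add: p PhiF)
  qed
  with \<epsilon> sQ cQ Q0 show ?thesis by blast
qed


section \<open>Failure of the Extended Courant Property\<close>

theorem proposition4p2:
  shows "\<exists>Q :: real \<Rightarrow> real.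
    smooth Q \<and> circle_fun Q \<and> (\<forall>x. Q x > 0) \<and>
    (\<exists>\<mu> \<Phi>. eigenfunction Q \<mu> \<Phi> \<and>
       infinite (components (torus_proj ` {p. \<Phi> p > 1}))) \<and>
    \<not> extended_courant_property Q"
proof -
  obtain \<epsilon> Q where \<epsilon>: "0 < \<epsilon>" "\<epsilon> < 1" and Q: "smooth Q" "circle_fun Q" "\<And>x. Q x > 0"
    and \<Phi>: "Phi \<epsilon> \<in> eigenspace Q 1"
    using Phi_eigenfunction by blast
  have CF: "conformal_factor Q" using Q by (simp add: conformal_factor_def)
  have val: "Phi \<epsilon> (0, 0) = 1" "Phi \<epsilon> (0, pi) = - 1"
    by (simp_all add: Phi_def profile_def flat_osc_def)
  then have ef: "eigenfunction Q 1 (Phi \<epsilon>)"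
    using \<Phi> by (auto simp: eigenfunction_def zero_fun_def)
  have "(\<lambda>_. 1) \<in> eigenspace Q 0"
    by (simp add: eigenspace_def torus_fun_def laplace_beltrami_def laplacian_def numeral_2_eq_2 case_prod_beta)
  then have ef0: "eigenfunction Q 0 (\<lambda>_. 1)"
    by (auto simp: eigenfunction_def zero_fun_def dest: fun_cong)
  \<comment> \<open>The number \<open>n\<close> is large enough for both \<open>\<Phi>\<close> and the constants to lie in \<open>L_space Q n\<close>.\<close>
  define n where "n = max (eigenvalue_count Q 0) (eigenvalue_count Q 1)"
  let ?w = "Phi \<epsilon> - (\<lambda>_. 1)"
  have w: "?w p = Phi \<epsilon> p - 1" for p by simp
  have "n \<ge> 1"
  proof -
    have "eigenvalue Q 1" using ef by (auto simp: eigenvalue_def)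
    from nth_eigenvalue_attained(1)[OF CF this] show ?thesis by (simp add: n_def)
  qed
  moreover have "?w \<in> L_space Q n"
  proof -
    have "Phi \<epsilon> \<in> L_space Q n" "(\<lambda>_. 1) \<in> L_space Q n"
      by (rule eigenfunction_in_L_space[OF CF ef] eigenfunction_in_L_space[OF CF ef0]; simp add: n_def)+
    then show ?thesis unfolding L_space_def by (rule span_diff)
  qed
  moreover have "?w \<noteq> 0"
    using val(2) w[of "(0, pi)"] by (metis one_neq_neg_one right_minus_eq zero_fun_apply)
  moreover have "infinite (nodal_domains ?w)"
    unfolding nodal_domains_def w by (rule infinite_components_of_nodal_sets[OF \<epsilon>]) auto
  ultimately have "\<not> extended_courant_property Q"
    unfolding extended_courant_property_def by blast
  moreover have "infinite (components (torus_proj ` {p. Phi \<epsilon> p > 1}))"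
    by (rule infinite_components_of_nodal_sets[OF \<epsilon>]) auto
  ultimately show ?thesis
    using Q ef by blast
qed

end
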